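(* Let $k$ be an algebraically closed field of characteristic $p$, $t$ transcendental over $k$, $d\ge2$, $N\ge1$ with $(d,p)\neq(2,2)$. If $f(x)\in H(d,N,k)$, then $\operatorname{Gal}(f^N(x)-t/k(t))\cong[S_d]^N$.
   Context: $H(d,N,k)$ is the set of polynomials $f\in k[x]$ of degree exactly $d$ such that: (1) $f'(x)$ is separable if $p\neq2$, and $f'(x)$ is the square of a separable polynomial if $p=2$; (2) if $w_1,\dots,w_r$ are the distinct critical points (zeros of $f'$) of $f$, then $f^n(w_i)\neq f^m(w_j)$ for all $1\le i,j\le r$ and all integers $0\le m,n\le N$, unless $m=n$ and $i=j$; (3) if $p=2$: for all $b,c\in k$, $(x-b)^3\nmid f(x)-c$; (4) if $p\mid d$: $f$ is indecomposable in $k[x]$ and $\deg f'=d-2$. $f^N$ is $N$-fold composition; $\operatorname{Gal}(f^N(x)-t/k(t))$ is the Galois group of the splitting field of $f^N(x)-t$ over $k(t)$. $[S_d]^N$ is the $N$-th wreath power of $S_d$ ($[S_d]^1=S_d$, $[S_d]^n=[S_d]^{n-1}[S_d]$, with $G[H]$ acting on pairs by $(i,r)\mapsto(\pi(i),\tau_i(r))$), i.e. the automorphism group of the $d$-ary rooted tree to level $N$. *)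

theory Defs
  imports "HOL-Computational_Algebra.Polynomial"
          "HOL-Computational_Algebra.Fraction_Field"
          "HOL-Algebra.Group"
begin

definition poly_iter :: "'a::comm_ring_1 poly \<Rightarrow> nat \<Rightarrow> 'a poly" where
  "poly_iter f N = ((\<lambda>g. pcompose f g) ^^ N) [:0, 1:]"

definition alg_closed_field :: "'k::field itself \<Rightarrow> bool" where
  "alg_closed_field _ \<longleftrightarrow> (\<forall>q::'k poly. degree q \<ge> 1 \<longrightarrow> (\<exists>x. poly q x = 0))"

definition separable_poly :: "'k::field poly \<Rightarrow> bool" where
  "separable_poly q \<longleftrightarrow> coprime q (pderiv q)"

definition indecomposable_poly :: "'k::field poly \<Rightarrow> bool" where
  "indecomposable_poly f \<longleftrightarrow>
     (\<forall>g h. f = pcompose g h \<longrightarrow> degree g = 1 \<or> degree h = 1)"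

definition critical_points :: "'k::field poly \<Rightarrow> 'k set" where
  "critical_points f = {w. poly (pderiv f) w = 0}"

definition H_set :: "nat \<Rightarrow> nat \<Rightarrow> 'k::field itself \<Rightarrow> 'k poly set" where
  "H_set d N _ = {f. degree f = d \<and>
     (CHAR('k) \<noteq> 2 \<longrightarrow> separable_poly (pderiv f)) \<and>
     (CHAR('k) = 2 \<longrightarrow> (\<exists>g. pderiv f = g ^ 2 \<and> separable_poly g)) \<and>
     (\<forall>w\<in>critical_points f. \<forall>w'\<in>critical_points f. \<forall>m\<le>N. \<forall>n\<le>N.
         (n, w) \<noteq> (m, w') \<longrightarrow> (poly f ^^ n) w \<noteq> (poly f ^^ m) w') \<and>
     (CHAR('k) = 2 \<longrightarrow> (\<forall>b c. \<not> [:-b, 1:] ^ 3 dvd f - [:c:])) \<and>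
     (CHAR('k) dvd d \<longrightarrow> indecomposable_poly f \<and> degree (pderiv f) = d - 2)}"

(* k(t) is the fraction field 'k poly fract, t = Fract [:0,1:] 1.
   The polynomial f^N(x) - t in k(t)[x]. *)
definition gal_poly :: "'k::field poly \<Rightarrow> nat \<Rightarrow> 'k poly fract poly" where
  "gal_poly f N = map_poly (\<lambda>c. Fract [:c:] 1) (poly_iter f N) - [:Fract [:0, 1:] 1:]"

definition is_field_hom :: "('a::field \<Rightarrow> 'b::field) \<Rightarrow> bool" where
  "is_field_hom \<phi> \<longleftrightarrow> \<phi> 1 = 1 \<and> (\<forall>x y. \<phi> (x + y) = \<phi> x + \<phi> y) \<and>
                       (\<forall>x y. \<phi> (x * y) = \<phi> x * \<phi> y)"

definition is_subfield :: "'b::field set \<Rightarrow> bool" where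
  "is_subfield S \<longleftrightarrow> 0 \<in> S \<and> 1 \<in> S \<and> (\<forall>x\<in>S. \<forall>y\<in>S. x + y \<in> S \<and> x * y \<in> S) \<and>
                    (\<forall>x\<in>S. - x \<in> S \<and> inverse x \<in> S)"

(* L (the whole type 'b) together with \<phi> : K \<rightarrow> L is a splitting field of P over K *)
definition is_splitting_field :: "('a::field \<Rightarrow> 'b::field) \<Rightarrow> 'a poly \<Rightarrow> bool" where
  "is_splitting_field \<phi> P \<longleftrightarrow> is_field_hom \<phi> \<and>
     (\<exists>c rs. map_poly \<phi> P = smult c (\<Prod>r\<leftarrow>rs. [:- r, 1:])) \<and>
     (\<forall>S. is_subfield S \<and> range \<phi> \<subseteq> S \<and> {x. poly (map_poly \<phi> P) x = 0} \<subseteq> S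
          \<longrightarrow> S = UNIV)"

definition gal_group :: "('a::field \<Rightarrow> 'b::field) \<Rightarrow> ('b \<Rightarrow> 'b) monoid" where
  "gal_group \<phi> = \<lparr> carrier = {\<sigma>. bij \<sigma> \<and> is_field_hom \<sigma> \<and> (\<forall>x. \<sigma> (\<phi> x) = \<phi> x)},
                   mult = (\<circ>), one = id \<rparr>"

(* vertices of the d-ary rooted tree to level N: words over {0..<d} of length \<le> N *)
definition tree_verts :: "nat \<Rightarrow> nat \<Rightarrow> nat list set" where
  "tree_verts d N = {v. length v \<le> N \<and> set v \<subseteq> {0..<d}}"

(* [S_d]^N realised as the automorphism group of the d-ary rooted tree of level N *)
definition wreath_power :: "nat \<Rightarrow> nat \<Rightarrow> (nat list \<Rightarrow> nat list) monoid" where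
  "wreath_power d N = \<lparr> carrier = {\<sigma>. bij_betw \<sigma> (tree_verts d N) (tree_verts d N) \<and>
        (\<forall>v. v \<notin> tree_verts d N \<longrightarrow> \<sigma> v = v) \<and>
        (\<forall>v\<in>tree_verts d N. length (\<sigma> v) = length v \<and> \<sigma> (butlast v) = butlast (\<sigma> v))},
     mult = (\<circ>), one = id \<rparr>"

end

theory Submission
  imports Defs
    "HOL-Computational_Algebra.Formal_Laurent_Series"
    "HOL-Computational_Algebra.Polynomial_FPS"
    "HOL-Computational_Algebra.Polynomial_Factorial"
    "HOL-Combinatorics.Transposition"
begin

text \<open>
  The roots of \<open>f^n(x) - t\<close>, \<open>n \<le> N\<close>, form the \<open>d\<close>-ary tree, and the Galois group acts on it
  faithfully. By induction on the levels it suffices that for every \<open>n\<close> each transposition of two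
  siblings of level \<open>n\<close> is induced on that level by the Galois group.

  One transposition exists: at the critical value \<open>c = f^n(w)\<close> the polynomial \<open>f^n - c\<close> has a single
  double root and otherwise simple roots, so over \<open>k((t - c))\<close> all but two of the roots of
  \<open>f^n(x) - t\<close> are rational and the other two are not. Being equal or exchanged by a transposition
  is then a Galois-invariant equivalence relation on level \<open>n\<close> that refines the sibling relation.
  Its class of a root \<open>\<beta>\<close> is a block, which by a Lueroth argument is the zero set of
  \<open>h(x) - h(\<beta>)\<close> for a right composition factor \<open>h\<close> of \<open>f\<close>. As \<open>f\<close> is indecomposable and the group
  is transitive on level \<open>n\<close>, the classes are the full sets of siblings.
\<close>

section \<open>Subfields and homomorphisms\<close>

definition polys_over :: "'a::zero set \<Rightarrow> 'a poly set" where
  "polys_over E = {p. \<forall>i. coeff p i \<in> E}"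

lemma polys_over_UNIV [simp]: "polys_over UNIV = UNIV"
  by (simp add: polys_over_def)

lemma coeff_polys_over: "p \<in> polys_over E \<Longrightarrow> coeff p i \<in> E"
  by (simp add: polys_over_def)

locale subring =
  fixes E :: "'a::comm_ring_1 set"
  assumes zero_closed [simp]: "0 \<in> E" and one_closed [simp]: "1 \<in> E"
    and add_closed: "x \<in> E \<Longrightarrow> y \<in> E \<Longrightarrow> x + y \<in> E"
    and mult_closed: "x \<in> E \<Longrightarrow> y \<in> E \<Longrightarrow> x * y \<in> E"
    and uminus_closed: "x \<in> E \<Longrightarrow> - x \<in> E"
begin

lemma diff_closed: "x \<in> E \<Longrightarrow> y \<in> E \<Longrightarrow> x - y \<in> E"
  using add_closed[of x "- y"] uminus_closed[of y] by simp

lemma sum_closed: "(\<And>i. i \<in> A \<Longrightarrow> g i \<in> E) \<Longrightarrow> sum g A \<in> E"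
  by (induction A rule: infinite_finite_induct) (auto intro: add_closed)

lemma polys_over_0: "0 \<in> polys_over E"
  by (simp add: polys_over_def)

lemma polys_over_pCons_iff: "pCons a p \<in> polys_over E \<longleftrightarrow> a \<in> E \<and> p \<in> polys_over E"
  by (force simp: polys_over_def coeff_pCons split: nat.splits)

lemma polys_over_1: "1 \<in> polys_over E"
  by (simp add: one_pCons polys_over_pCons_iff polys_over_0)

lemma polys_over_add: "p \<in> polys_over E \<Longrightarrow> q \<in> polys_over E \<Longrightarrow> p + q \<in> polys_over E"
  by (simp add: polys_over_def add_closed)

lemma polys_over_diff: "p \<in> polys_over E \<Longrightarrow> q \<in> polys_over E \<Longrightarrow> p - q \<in> polys_over E"
  by (simp add: polys_over_def diff_closed)

lemma polys_over_mult: "p \<in> polys_over E \<Longrightarrow> q \<in> polys_over E \<Longrightarrow> p * q \<in> polys_over E"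
  by (auto simp: polys_over_def coeff_mult intro!: sum_closed mult_closed)

lemma polys_over_smult: "a \<in> E \<Longrightarrow> p \<in> polys_over E \<Longrightarrow> smult a p \<in> polys_over E"
  by (simp add: polys_over_def mult_closed)

lemma polys_over_prod: "(\<And>i. i \<in> A \<Longrightarrow> g i \<in> polys_over E) \<Longrightarrow> prod g A \<in> polys_over E"
  by (induction A rule: infinite_finite_induct) (auto intro: polys_over_1 polys_over_mult)

lemma poly_closed: "p \<in> polys_over E \<Longrightarrow> x \<in> E \<Longrightarrow> poly p x \<in> E"
  by (induction p) (auto simp: polys_over_pCons_iff intro: add_closed mult_closed)

end

locale subring_hom = subring E for E :: "'a::comm_ring_1 set" +
  fixes h :: "'a \<Rightarrow> 'b::comm_ring_1"
  assumes hom_1 [simp]: "h 1 = 1"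
    and hom_add: "x \<in> E \<Longrightarrow> y \<in> E \<Longrightarrow> h (x + y) = h x + h y"
    and hom_mult: "x \<in> E \<Longrightarrow> y \<in> E \<Longrightarrow> h (x * y) = h x * h y"
begin

lemma hom_0 [simp]: "h 0 = 0"
  using hom_add[of 0 0] by simp

lemma hom_uminus: "x \<in> E \<Longrightarrow> h (- x) = - h x"
  using hom_add[of x "- x"] uminus_closed[of x] by (simp add: eq_neg_iff_add_eq_0 add.commute)

lemma hom_diff: "x \<in> E \<Longrightarrow> y \<in> E \<Longrightarrow> h (x - y) = h x - h y"
  using hom_add[of x "- y"] by (simp add: hom_uminus uminus_closed)

lemma hom_sum: "(\<And>i. i \<in> A \<Longrightarrow> g i \<in> E) \<Longrightarrow> h (sum g A) = (\<Sum>i\<in>A. h (g i))"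
  by (induction A rule: infinite_finite_induct) (auto simp: hom_add sum_closed)

lemma coeff_map_poly_hom: "coeff (map_poly h p) i = h (coeff p i)"
  by (simp add: coeff_map_poly)

lemma map_poly_hom_pCons: "map_poly h (pCons a p) = pCons (h a) (map_poly h p)"
  by (simp add: map_poly_pCons)

lemma map_poly_hom_const: "map_poly h [:a:] = [:h a:]"
  by (simp add: map_poly_hom_pCons)

lemma map_poly_hom_X: "map_poly h [:0, 1:] = [:0, 1:]"
  by (simp add: map_poly_hom_pCons)

lemma map_poly_hom_linear: "b \<in> E \<Longrightarrow> map_poly h [:- b, 1:] = [:- h b, 1:]"
  by (simp add: map_poly_hom_pCons hom_uminus)

lemma map_poly_hom_add:
  "p \<in> polys_over E \<Longrightarrow> q \<in> polys_over E \<Longrightarrow> map_poly h (p + q) = map_poly h p + map_poly h q"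
  by (rule poly_eqI) (simp add: coeff_map_poly_hom coeff_polys_over hom_add)

lemma map_poly_hom_diff:
  "p \<in> polys_over E \<Longrightarrow> q \<in> polys_over E \<Longrightarrow> map_poly h (p - q) = map_poly h p - map_poly h q"
  by (rule poly_eqI) (simp add: coeff_map_poly_hom coeff_polys_over hom_diff)

lemma map_poly_hom_smult:
  "a \<in> E \<Longrightarrow> p \<in> polys_over E \<Longrightarrow> map_poly h (smult a p) = smult (h a) (map_poly h p)"
  by (rule poly_eqI) (simp add: coeff_map_poly_hom coeff_polys_over hom_mult)

lemma map_poly_hom_mult:
  "p \<in> polys_over E \<Longrightarrow> q \<in> polys_over E \<Longrightarrow> map_poly h (p * q) = map_poly h p * map_poly h q"
  by (rule poly_eqI)
    (simp add: coeff_map_poly_hom coeff_mult hom_sum hom_mult mult_closed coeff_polys_over)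

lemma map_poly_hom_prod:
  "(\<And>i. i \<in> A \<Longrightarrow> g i \<in> polys_over E) \<Longrightarrow> map_poly h (prod g A) = (\<Prod>i\<in>A. map_poly h (g i))"
  by (induction A rule: infinite_finite_induct) (auto simp: map_poly_hom_mult polys_over_prod)

lemma poly_map_poly_hom:
  "p \<in> polys_over E \<Longrightarrow> x \<in> E \<Longrightarrow> poly (map_poly h p) (h x) = h (poly p x)"
  by (induction p)
    (auto simp: map_poly_hom_pCons polys_over_pCons_iff hom_add hom_mult poly_closed mult_closed)

end

locale inj_subring_hom = subring_hom +
  assumes hom_eq_0_iff: "x \<in> E \<Longrightarrow> h x = 0 \<longleftrightarrow> x = 0"
begin

lemma hom_eq_iff: "x \<in> E \<Longrightarrow> y \<in> E \<Longrightarrow> h x = h y \<longleftrightarrow> x = y"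
  using hom_eq_0_iff[of "x - y"] by (simp add: hom_diff diff_closed)

lemma inj_on_hom: "A \<subseteq> E \<Longrightarrow> inj_on h A"
  by (auto simp: inj_on_def hom_eq_iff subset_iff)

lemma degree_map_poly_hom: "p \<in> polys_over E \<Longrightarrow> degree (map_poly h p) = degree p"
  by (cases "p = 0") (auto intro!: map_poly_degree_eq simp: hom_eq_0_iff coeff_polys_over)

lemma map_poly_hom_eq_0_iff: "p \<in> polys_over E \<Longrightarrow> map_poly h p = 0 \<longleftrightarrow> p = 0"
  by (simp add: poly_eq_iff coeff_map_poly_hom hom_eq_0_iff coeff_polys_over)

lemma map_poly_hom_eq_iff:
  "p \<in> polys_over E \<Longrightarrow> q \<in> polys_over E \<Longrightarrow> map_poly h p = map_poly h q \<longleftrightarrow> p = q"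
  by (simp add: poly_eq_iff coeff_map_poly_hom hom_eq_iff coeff_polys_over)

end

locale comm_ring_hom =
  fixes h :: "'a::comm_ring_1 \<Rightarrow> 'b::comm_ring_1"
  assumes subring_hom_UNIV: "subring_hom UNIV h"

text \<open>The rewrite rules discharge the premises \<open>x \<in> UNIV\<close> of the inherited facts.\<close>

sublocale comm_ring_hom \<subseteq> subring_hom UNIV h
  rewrites "\<And>x. x \<in> UNIV \<equiv> True" and "\<And>A. A \<subseteq> UNIV \<equiv> True"
    and "\<And>p. p \<in> polys_over UNIV \<equiv> True" and "\<And>P. (True \<Longrightarrow> P) \<equiv> Trueprop P"
  by (rule subring_hom_UNIV) auto

locale inj_comm_ring_hom = comm_ring_hom +
  assumes inj_subring_hom_UNIV: "inj_subring_hom UNIV h"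

sublocale inj_comm_ring_hom \<subseteq> inj_subring_hom UNIV h
  rewrites "\<And>x. x \<in> UNIV \<equiv> True" and "\<And>A. A \<subseteq> UNIV \<equiv> True"
    and "\<And>p. p \<in> polys_over UNIV \<equiv> True" and "\<And>P. (True \<Longrightarrow> P) \<equiv> Trueprop P"
  by (rule inj_subring_hom_UNIV) auto

lemma (in comm_ring_hom) hom_of_nat: "h (of_nat n) = of_nat n"
  by (induction n) (simp_all add: hom_add)

lemma (in comm_ring_hom) map_poly_hom_pcompose:
  "map_poly h (pcompose p q) = pcompose (map_poly h p) (map_poly h q)"
  by (induction p)
    (simp_all add: pcompose_pCons map_poly_hom_pCons map_poly_hom_add map_poly_hom_mult)

locale subfield = subring E for E :: "'a::field set" +
  assumes inverse_closed: "x \<in> E \<Longrightarrow> inverse x \<in> E"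
begin

lemma divide_closed: "x \<in> E \<Longrightarrow> y \<in> E \<Longrightarrow> x / y \<in> E"
  by (simp add: divide_inverse mult_closed inverse_closed)

lemma polys_over_div_mod:
  assumes q: "q \<in> polys_over E"
  shows "p \<in> polys_over E \<Longrightarrow> p div q \<in> polys_over E \<and> p mod q \<in> polys_over E"
proof (induction p)
  case (pCons a p)
  then have "pCons a (p mod q) \<in> polys_over E" and div: "p div q \<in> polys_over E"
    by (simp_all add: polys_over_pCons_iff)
  moreover from this q have "coeff (pCons a (p mod q)) (degree q) / lead_coeff q \<in> E"
    by (intro divide_closed coeff_polys_over)
  ultimately show ?case
    using q by (auto simp: div_pCons_eq mod_pCons_eq polys_over_pCons_iff polys_over_0
        polys_over_diff polys_over_smult)
qed (simp add: polys_over_0)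

lemmas polys_over_div = polys_over_div_mod[THEN conjunct1]
  and polys_over_mod = polys_over_div_mod[THEN conjunct2]

end

lemma is_subfield_iff: "is_subfield E \<longleftrightarrow> subfield E"
  unfolding is_subfield_def subfield_def subfield_axioms_def subring_def by auto

locale subfield_hom = subfield E + subring_hom E h
  for E :: "'a::field set" and h :: "'a \<Rightarrow> 'b::field"

sublocale subfield_hom \<subseteq> inj_subring_hom E h
proof
  fix x assume "x \<in> E"
  then show "h x = 0 \<longleftrightarrow> x = 0"
    using hom_mult[of x "inverse x"] by (cases "x = 0") (auto simp: inverse_closed)
qed

context subfield_hom
begin

lemma hom_inverse: "x \<in> E \<Longrightarrow> h (inverse x) = inverse (h x)"
  using hom_mult[of x "inverse x"] inverse_unique[of "h x" "h (inverse x)"]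
  by (cases "x = 0") (auto simp: inverse_closed)

lemma hom_divide: "x \<in> E \<Longrightarrow> y \<in> E \<Longrightarrow> h (x / y) = h x / h y"
  by (simp add: divide_inverse hom_mult hom_inverse inverse_closed)

lemma map_poly_hom_dvd:
  assumes "p \<in> polys_over E" "q \<in> polys_over E" "p dvd q"
  shows "map_poly h p dvd map_poly h q"
proof -
  have "map_poly h q = map_poly h p * map_poly h (q div p)"
    using assms by (simp flip: map_poly_hom_mult add: polys_over_div)
  then show ?thesis by simp
qed

end

lemma (in subfield) subfield_hom_id: "subfield_hom E id"
  by unfold_locales simp_all

locale field_hom = comm_ring_hom h for h :: "'a::field \<Rightarrow> 'b::field"

lemma is_field_hom_iff: "is_field_hom h \<longleftrightarrow> field_hom h"
  by (auto simp: is_field_hom_def field_hom_def comm_ring_hom_def subring_hom_def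
      subring_hom_axioms_def subring_def)

sublocale field_hom \<subseteq> subfield_hom UNIV h
  rewrites "\<And>x. x \<in> UNIV \<equiv> True" and "\<And>A. A \<subseteq> UNIV \<equiv> True"
    and "\<And>p. p \<in> polys_over UNIV \<equiv> True" and "\<And>P. (True \<Longrightarrow> P) \<equiv> Trueprop P"
proof -
  interpret UNIV: subring_hom UNIV h by (rule subring_hom_UNIV)
  show "subfield_hom UNIV h" by unfold_locales simp
qed auto

sublocale field_hom \<subseteq> inj_comm_ring_hom h
  by unfold_locales (rule hom_eq_0_iff)

lemma (in field_hom) map_poly_hom_pderiv: "map_poly h (pderiv p) = pderiv (map_poly h p)"
  by (rule poly_eqI) (simp add: coeff_map_poly_hom coeff_pderiv hom_mult hom_of_nat del: of_nat_Suc)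

lemma (in field_hom) subfield_range: "subfield (range h)"
proof
  fix x y assume "x \<in> range h" "y \<in> range h"
  then obtain a b where "x = h a" "y = h b" by blast
  then show "x + y \<in> range h" "x * y \<in> range h" "- x \<in> range h" "inverse x \<in> range h"
    by (simp_all flip: hom_add hom_mult hom_uminus hom_inverse)
qed (use hom_0 hom_1 in \<open>metis rangeI\<close>)+

section \<open>Zeros of split polynomials\<close>

abbreviation zeros :: "'a::idom poly \<Rightarrow> 'a set" where
  "zeros p \<equiv> {x. poly p x = 0}"

definition splits :: "'a::field poly \<Rightarrow> bool" where
  "splits p \<longleftrightarrow> p \<noteq> 0 \<and> (\<forall>s. s dvd p \<longrightarrow> degree s > 0 \<longrightarrow> (\<exists>x. poly s x = 0))"

lemma linear_factorE:
  fixes p :: "'a::idom poly"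
  assumes "poly p a = 0"
  obtains q where "p = [:- a, 1:] * q"
  using assms by (metis dvd_def poly_eq_0_iff_dvd)

lemma splits_dvd: "splits p \<Longrightarrow> q dvd p \<Longrightarrow> splits q"
  unfolding splits_def by (metis dvd_0_left dvd_trans)

lemma splits_zero_exists: "splits p \<Longrightarrow> degree p > 0 \<Longrightarrow> \<exists>x. poly p x = 0"
  by (simp add: splits_def)

lemma splits_linear_mult:
  assumes "splits p"
  shows "splits ([:- a, 1:] * p)"
  unfolding splits_def
proof (intro conjI allI impI)
  show "[:- a, 1:] * p \<noteq> 0" using assms by (simp add: splits_def del: mult_pCons_left)
  fix s assume s: "s dvd [:- a, 1:] * p" "degree s > 0"
  then obtain t where t: "[:- a, 1:] * p = s * t" by (auto simp: dvd_def)
  show "\<exists>x. poly s x = 0"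
  proof (cases "poly s a = 0")
    case False
    have "poly s a * poly t a = poly ([:- a, 1:] * p) a" by (simp only: t poly_mult)
    with False have "poly t a = 0" by simp
    then obtain t' where "t = [:- a, 1:] * t'" using linear_factorE by blast
    with t have "[:- a, 1:] * p = [:- a, 1:] * (s * t')" by (simp only: mult_ac)
    then have "s dvd p" by (simp only: mult_cancel_left) simp
    then show ?thesis using assms s(2) by (simp add: splits_def)
  qed blast
qed

lemma splits_smult_prod_list_linear:
  assumes "c \<noteq> 0"
  shows "splits (smult c (\<Prod>r\<leftarrow>rs. [:- r, 1:]))"
proof (induction rs)
  case Nil
  show ?case using assms by (auto simp: splits_def const_poly_dvd_iff dest!: dvd_imp_degree_le)
next
  case (Cons r rs)
  from splits_linear_mult[OF this, of r] show ?case
    by (simp only: list.map prod_list.Cons mult_smult_right)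
qed

lemma order_power_linear:
  fixes a :: "'a::idom"
  shows "order x ([:- a, 1:] ^ n) = (if x = a then n else 0)"
  by (simp add: order_power_n_n order_0I)

lemma splits_sum_order:
  "splits p \<Longrightarrow> (\<Sum>x\<in>zeros p. order x p) = degree p"
proof (induction p rule: poly_root_order_induct)
  case (no_roots p)
  then show ?case using splits_zero_exists by auto
next
  case (root p a n)
  have nz: "[:- a, 1:] ^ n \<noteq> 0" "p \<noteq> 0" using root.hyps(2) by (auto simp del: mult_pCons_left)
  have order: "order x ([:- a, 1:] ^ n * p) = (if x = a then n else order x p)" for x
    using nz root.hyps(2) by (simp add: order_mult order_power_linear order_0I del: mult_pCons_left)
  have "zeros ([:- a, 1:] ^ n * p) = insert a (zeros p)" using root.hyps(1) by auto
  moreover have "(\<Sum>x\<in>zeros p. if x = a then n else order x p) = (\<Sum>x\<in>zeros p. order x p)"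
    using root.hyps(2) by (intro sum.cong) auto
  ultimately have "(\<Sum>x\<in>zeros ([:- a, 1:] ^ n * p). order x ([:- a, 1:] ^ n * p)) = n + degree p"
    using root.IH splits_dvd[OF root.prems dvd_triv_right] poly_roots_finite[OF nz(2)] root.hyps(2)
    by (simp add: order)
  then show ?case using nz by (simp add: degree_mult_eq degree_power_eq del: mult_pCons_left)
qed (simp add: splits_def)

lemma square_linear_dvd_iff:
  fixes p :: "'a::field poly"
  shows "[:- a, 1:] ^ 2 dvd p \<longleftrightarrow> poly p a = 0 \<and> poly (pderiv p) a = 0"
proof (cases "poly p a = 0")
  case True
  then obtain q where q: "p = [:- a, 1:] * q" by (rule linear_factorE)
  have "poly (pderiv p) a = poly q a" unfolding q pderiv_mult by (simp add: pderiv_pCons)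
  moreover have "[:- a, 1:] ^ 2 dvd p \<longleftrightarrow> [:- a, 1:] dvd q"
    unfolding q power2_eq_square by (subst dvd_mult_cancel_left) simp
  ultimately show ?thesis using True by (simp add: poly_eq_0_iff_dvd)
next
  case False
  then show ?thesis by (metis dvd_mult_left poly_eq_0_iff_dvd power2_eq_square)
qed

lemma order_eq_1I:
  fixes p :: "'a::field poly"
  assumes "poly p a = 0" "poly (pderiv p) a \<noteq> 0"
  shows "order a p = 1"
proof -
  have "p \<noteq> 0" using assms(2) by auto
  then have "order a p > 0" using assms(1) by (simp add: order_gt_0_iff)
  moreover have "\<not> 2 \<le> order a p" using assms(2) square_linear_dvd_iff[of a p]
    by (simp add: order_divides)
  ultimately show ?thesis by simp
qed

lemma splits_card_simple_zeros:
  assumes "splits p" "\<And>x. poly p x = 0 \<Longrightarrow> poly (pderiv p) x \<noteq> 0"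
  shows "card (zeros p) = degree p"
proof -
  have "card (zeros p) = (\<Sum>x\<in>zeros p. order x p)" by (simp add: order_eq_1I assms(2))
  then show ?thesis using splits_sum_order[OF assms(1)] by simp
qed

lemma splits_card_zeros_except:
  assumes "splits p" "poly p w = 0" "\<And>x. poly p x = 0 \<Longrightarrow> x \<noteq> w \<Longrightarrow> poly (pderiv p) x \<noteq> 0"
  shows "card (zeros p - {w}) + order w p = degree p"
proof -
  have "finite (zeros p)" using assms(1) by (intro poly_roots_finite) (simp add: splits_def)
  then have "(\<Sum>x\<in>zeros p. order x p) = order w p + (\<Sum>x\<in>zeros p - {w}. order x p)"
    using assms(2) by (intro sum.remove) simp_all
  also have "(\<Sum>x\<in>zeros p - {w}. order x p) = card (zeros p - {w})"
    by (simp add: order_eq_1I assms(3))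
  finally show ?thesis using splits_sum_order[OF assms(1)] by simp
qed

definition splits_separably :: "'a::field poly \<Rightarrow> bool" where
  "splits_separably p \<longleftrightarrow> p \<noteq> 0 \<and> card (zeros p) = degree p"

lemma splits_separably_dvd:
  assumes "splits_separably p" "q dvd p"
  shows "splits_separably q"
proof -
  obtain r where r: "p = q * r" using assms(2) by (auto simp: dvd_def)
  have nz: "q \<noteq> 0" "r \<noteq> 0" using r assms(1) by (auto simp: splits_separably_def)
  have "degree q + degree r = card (zeros p)"
    using assms(1) nz by (simp add: splits_separably_def r degree_mult_eq)
  also have "zeros p = zeros q \<union> zeros r" using r by auto
  also have "card \<dots> \<le> card (zeros q) + card (zeros r)" by (rule card_Un_le)
  also have "card (zeros r) \<le> degree r" by (rule card_poly_roots_bound[OF nz(2)])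
  finally show ?thesis using card_poly_roots_bound[OF nz(1)] nz(1)
    by (simp add: splits_separably_def)
qed

lemma splits_separably_imp_splits:
  assumes "splits_separably p"
  shows "splits p"
  unfolding splits_def
proof (intro conjI allI impI)
  fix s assume "s dvd p" "degree s > 0"
  then have "card (zeros s) > 0"
    using splits_separably_dvd[OF assms] by (simp add: splits_separably_def)
  then show "\<exists>x. poly s x = 0" by (metis (mono_tags) card.empty empty_Collect_eq less_irrefl)
qed (use assms in \<open>simp add: splits_separably_def\<close>)

lemma degree_prod_linear:
  fixes B :: "'a::idom set"
  assumes "finite B"
  shows "degree (\<Prod>b\<in>B. [:- b, 1:]) = card B"
  using assms by (subst degree_prod_eq_sum_degree) auto

lemma prod_linear_dvd:
  fixes p :: "'a::idom poly"
  assumes "finite B" "B \<subseteq> zeros p"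
  shows "(\<Prod>b\<in>B. [:- b, 1:]) dvd p"
  using assms
proof (induction B arbitrary: p rule: finite_induct)
  case (insert a B)
  then obtain q where q: "p = [:- a, 1:] * q" using linear_factorE[of p a] by blast
  have "B \<subseteq> zeros q" using insert.prems insert.hyps by (auto simp: q simp del: mult_pCons_left)
  then have "(\<Prod>b\<in>B. [:- b, 1:]) dvd q" by (rule insert.IH)
  then show ?case using insert.hyps by (simp add: q mult_dvd_mono del: mult_pCons_left)
qed simp

lemma (in field_hom) map_poly_hom_prod_linear:
  "map_poly h (\<Prod>b\<in>B. [:- b, 1:]) = (\<Prod>b\<in>h ` B. [:- b, 1:])"
  by (simp add: map_poly_hom_prod map_poly_hom_linear prod.reindex inj_on_hom)

lemma (in field_hom) zero_in_range_if_splits: "splits p \<Longrightarrow> poly (map_poly h p) x = 0 \<Longrightarrow> x \<in> range h"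
proof (induction p rule: poly_root_order_induct)
  case (no_roots p)
  then have "degree p = 0" using splits_zero_exists by auto
  then obtain c where "p = [:c:]" by (rule degree_eq_zeroE)
  then show ?case using no_roots by (auto simp: splits_def map_poly_hom_const hom_eq_0_iff)
next
  case (root p a n)
  have power: "map_poly h ([:- a, 1:] ^ n) = [:- h a, 1:] ^ n"
    by (induction n) (simp_all add: map_poly_hom_mult map_poly_hom_linear del: mult_pCons_left)
  have "(x - h a) ^ n * poly (map_poly h p) x = 0"
    using root.prems(2) by (simp add: map_poly_hom_mult power del: mult_pCons_left)
  then have "x = h a \<or> poly (map_poly h p) x = 0" by auto
  then show ?case using root.IH splits_dvd[OF root.prems(1)] by auto
qed (simp add: splits_def)

lemma poly_mod_at_zero:
  fixes m q :: "'a::field poly"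
  assumes "poly m x = 0"
  shows "poly (q mod m) x = poly q x"
proof -
  have "poly q x = poly (m * (q div m) + q mod m) x" by simp
  also have "\<dots> = poly (q mod m) x" by (simp only: poly_add poly_mult assms) simp
  finally show ?thesis ..
qed

section \<open>Minimal polynomials and simple extensions\<close>

text \<open>The minimal polynomial of \<open>r\<close> over \<open>E\<close>, where \<open>E\<close> acts on the codomain through \<open>h\<close>.\<close>

definition is_minpoly :: "'a::field set \<Rightarrow> ('a \<Rightarrow> 'b::field) \<Rightarrow> 'b \<Rightarrow> 'a poly \<Rightarrow> bool" where
  "is_minpoly E h r m \<longleftrightarrow> m \<in> polys_over E \<and> m \<noteq> 0 \<and> poly (map_poly h m) r = 0 \<and>
     (\<forall>q\<in>polys_over E. q \<noteq> 0 \<longrightarrow> poly (map_poly h q) r = 0 \<longrightarrow> degree m \<le> degree q)"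

definition adjoin :: "'a::comm_ring_1 set \<Rightarrow> 'a \<Rightarrow> 'a set" where
  "adjoin E x = (\<lambda>q. poly q x) ` polys_over E"

text \<open>The value at \<open>q(x)\<close> is \<open>h(q)(r)\<close>; this is well defined if \<open>r\<close> is a zero of the image of the
  minimal polynomial of \<open>x\<close>.\<close>

definition extend_hom ::
    "'a::field set \<Rightarrow> ('a \<Rightarrow> 'b::field) \<Rightarrow> 'a \<Rightarrow> 'b \<Rightarrow> 'a \<Rightarrow> 'b" where
  "extend_hom E h x r y = poly (map_poly h (SOME q. q \<in> polys_over E \<and> poly q x = y)) r"

context subring
begin

lemma subring_adjoin: "subring (adjoin E x)"
proof
  show "0 \<in> adjoin E x" "1 \<in> adjoin E x"
    unfolding adjoin_def using polys_over_0 polys_over_1 by force+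
  fix y z assume "y \<in> adjoin E x" "z \<in> adjoin E x"
  then obtain p q where p: "p \<in> polys_over E" "y = poly p x"
    and q: "q \<in> polys_over E" "z = poly q x"
    by (auto simp: adjoin_def)
  show "y + z \<in> adjoin E x" unfolding adjoin_def
    by (rule image_eqI[OF _ polys_over_add[OF p(1) q(1)]]) (simp add: p q)
  show "y * z \<in> adjoin E x" unfolding adjoin_def
    by (rule image_eqI[OF _ polys_over_mult[OF p(1) q(1)]]) (simp add: p q)
  show "- y \<in> adjoin E x" unfolding adjoin_def
    by (rule image_eqI[OF _ polys_over_diff[OF polys_over_0 p(1)]]) (simp add: p)
qed

lemma subset_adjoin: "E \<subseteq> adjoin E x"
proof
  fix a assume "a \<in> E"
  then have "[:a:] \<in> polys_over E" by (simp add: polys_over_pCons_iff polys_over_0)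
  then show "a \<in> adjoin E x" unfolding adjoin_def by force
qed

lemma polys_over_X: "[:0, 1:] \<in> polys_over E"
  by (simp add: polys_over_pCons_iff polys_over_0)

lemma in_adjoin: "x \<in> adjoin E x"
  unfolding adjoin_def using polys_over_X by force

end

context subfield_hom
begin

lemma minpoly_exists:
  assumes "p \<in> polys_over E" "p \<noteq> 0" "poly (map_poly h p) r = 0"
  obtains m where "is_minpoly E h r m"
  using assms
    ex_has_least_nat[of "\<lambda>q. q \<in> polys_over E \<and> q \<noteq> 0 \<and> poly (map_poly h q) r = 0" p degree]
  unfolding is_minpoly_def by blast

lemma minpoly_dvd:
  assumes m: "is_minpoly E h r m" and q: "q \<in> polys_over E" "poly (map_poly h q) r = 0"
  shows "m dvd q"
proof -
  have m_over_E: "m \<in> polys_over E" "m \<noteq> 0" "poly (map_poly h m) r = 0" using m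
    by (auto simp: is_minpoly_def)
  have "map_poly h q = map_poly h m * map_poly h (q div m) + map_poly h (q mod m)"
    using m_over_E(1) q(1)
    by (simp flip: map_poly_hom_mult map_poly_hom_add
        add: polys_over_div polys_over_mod polys_over_mult)
  then have "poly (map_poly h (q mod m)) r = 0" using q(2) m_over_E(3) by simp
  then have "q mod m = 0 \<or> degree m \<le> degree (q mod m)"
    using m q(1) m_over_E(1) polys_over_mod unfolding is_minpoly_def by blast
  then have "q mod m = 0" using degree_mod_less[OF m_over_E(2), of q] by auto
  then show ?thesis by (simp add: mod_eq_0_iff_dvd)
qed

lemma minpoly_degree_pos:
  assumes "is_minpoly E h r m"
  shows "degree m > 0"
proof (rule ccontr)
  assume "\<not> ?thesis"
  then obtain c where "m = [:c:]" by (metis degree_eq_zeroE neq0_conv)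
  then show False using assms
    by (auto simp: is_minpoly_def map_poly_hom_const hom_eq_0_iff polys_over_pCons_iff)
qed

end

context subfield
begin

interpretation inclusion: subfield_hom E id
  by (rule subfield_hom_id)

lemma poly_at_algebraic_invertible:
  assumes m: "is_minpoly E id x m"
  shows "r \<in> polys_over E \<Longrightarrow> poly r x \<noteq> 0 \<Longrightarrow> \<exists>s\<in>polys_over E. poly s x * poly r x = 1"
proof (induction "degree r" arbitrary: r rule: less_induct)
  case less
  have m_over_E: "m \<in> polys_over E" "m \<noteq> 0" "poly m x = 0" using m by (auto simp: is_minpoly_def)
  have r0: "r \<noteq> 0" using less.prems(2) by auto
  consider (const) "degree r = 0" | (large) "degree m \<le> degree r"
    | (small) "0 < degree r" "degree r < degree m"
    by linarith
  then show ?case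
  proof cases
    case const
    then obtain c where c: "r = [:c:]" by (rule degree_eq_zeroE)
    then have "[:inverse c:] \<in> polys_over E" "c \<noteq> 0"
      using less.prems by (auto simp: polys_over_pCons_iff polys_over_0 inverse_closed)
    then show ?thesis using c by (intro bexI[of _ "[:inverse c:]"]) simp_all
  next
    case large
    have eq: "poly (r mod m) x = poly r x" by (rule poly_mod_at_zero[OF m_over_E(3)])
    then have "r mod m \<noteq> 0" using less.prems(2) by auto
    then have "degree (r mod m) < degree r" using degree_mod_less[OF m_over_E(2), of r] large by simp
    then show ?thesis using less.hyps[of "r mod m"] eq less.prems polys_over_mod[OF m_over_E(1)] by simp
  next
    case small
    have div: "m div r \<in> polys_over E" using polys_over_div less.prems(1) m_over_E(1) .
    have "poly m x = poly (r * (m div r) + m mod r) x" by simp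
    then have eq: "poly (m mod r) x = - (poly r x * poly (m div r) x)"
      unfolding m_over_E(3) by (simp only: poly_add poly_mult) (simp add: eq_neg_iff_add_eq_0 add.commute)
    have "m div r \<noteq> 0" using small by (simp add: div_poly_eq_0_iff r0 m_over_E(2))
    moreover have "degree (m div r) < degree m" using small by (simp add: degree_div_less)
    ultimately have "poly (m div r) x \<noteq> 0" using m div unfolding is_minpoly_def by fastforce
    then have nz: "poly (m mod r) x \<noteq> 0" using eq less.prems(2) by simp
    then have "degree (m mod r) < degree r" using degree_mod_less[OF r0, of m] by auto
    then obtain s where s: "s \<in> polys_over E" "poly s x * poly (m mod r) x = 1"
      using less.hyps nz polys_over_mod[OF less.prems(1) m_over_E(1)] by blast
    have "poly (- (s * (m div r))) x * poly r x = 1" using s(2) by (simp add: eq mult_ac)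
    moreover have "- (s * (m div r)) \<in> polys_over E"
      using polys_over_diff[OF polys_over_0 polys_over_mult[OF s(1) div]] by simp
    ultimately show ?thesis by blast
  qed
qed

lemma subfield_adjoin:
  assumes "is_minpoly E id x m"
  shows "subfield (adjoin E x)"
proof -
  interpret adjoin: subring "adjoin E x" by (rule subring_adjoin)
  show ?thesis
  proof
    fix y assume "y \<in> adjoin E x"
    then obtain r where r: "r \<in> polys_over E" "y = poly r x" by (auto simp: adjoin_def)
    show "inverse y \<in> adjoin E x"
    proof (cases "y = 0")
      case False
      then obtain s where "s \<in> polys_over E" "poly s x * y = 1"
        using poly_at_algebraic_invertible[OF assms] r by blast
      then show ?thesis by (metis adjoin_def imageI inverse_unique mult.commute)
    qed simp
  qed
qed

end

context subfield_hom
begin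

context
  fixes x r m
  assumes m: "is_minpoly E id x m" and r: "poly (map_poly h m) r = 0"
begin

lemma extend_hom_poly:
  assumes q: "q \<in> polys_over E"
  shows "extend_hom E h x r (poly q x) = poly (map_poly h q) r"
proof -
  define q' where "q' = (SOME q'. q' \<in> polys_over E \<and> poly q' x = poly q x)"
  have q': "q' \<in> polys_over E" "poly q' x = poly q x"
    unfolding q'_def using someI[of "\<lambda>q'. q' \<in> polys_over E \<and> poly q' x = poly q x" q] q by auto
  interpret inclusion: subfield_hom E id by (rule subfield_hom_id)
  have "m dvd q - q'"
    using inclusion.minpoly_dvd[OF m polys_over_diff[OF q q'(1)]] q'(2) by simp
  then have "map_poly h m dvd map_poly h (q - q')"
    using m polys_over_diff[OF q q'(1)] by (intro map_poly_hom_dvd) (auto simp: is_minpoly_def)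
  then have "poly (map_poly h (q - q')) r = 0" using r by (metis dvdE mult_zero_left poly_mult)
  then show ?thesis by (simp add: extend_hom_def q'_def[symmetric] map_poly_hom_diff[OF q q'(1)])
qed

lemma subfield_hom_extend_hom: "subfield_hom (adjoin E x) (extend_hom E h x r)"
proof -
  interpret adjoin: subfield "adjoin E x" by (rule subfield_adjoin[OF m])
  show ?thesis
  proof
    show "extend_hom E h x r 1 = 1" using extend_hom_poly[OF polys_over_1] by simp
    fix y z assume "y \<in> adjoin E x" "z \<in> adjoin E x"
    then obtain p q where p: "p \<in> polys_over E" "y = poly p x"
      and q: "q \<in> polys_over E" "z = poly q x"
      by (auto simp: adjoin_def)
    show "extend_hom E h x r (y + z) = extend_hom E h x r y + extend_hom E h x r z"
      using extend_hom_poly[OF polys_over_add[OF p(1) q(1)]]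
      by (simp add: p q extend_hom_poly map_poly_hom_add)
    show "extend_hom E h x r (y * z) = extend_hom E h x r y * extend_hom E h x r z"
      using extend_hom_poly[OF polys_over_mult[OF p(1) q(1)]]
      by (simp add: p q extend_hom_poly map_poly_hom_mult)
  qed
qed

lemma extend_hom_base:
  assumes "y \<in> E"
  shows "extend_hom E h x r y = h y"
  using extend_hom_poly[of "[:y:]"] assms
  by (simp add: polys_over_pCons_iff polys_over_0 map_poly_hom_const)

lemma extend_hom_generator: "extend_hom E h x r x = r"
  using extend_hom_poly[OF polys_over_X] by (simp add: map_poly_hom_X)

end

lemma extend_to_zero:
  assumes Q: "Q \<in> polys_over E" "splits Q" and r: "poly (map_poly h Q) r = 0"
  obtains E' h' b where "subfield_hom E' h'" "E \<subseteq> E'" "\<And>y. y \<in> E \<Longrightarrow> h' y = h y"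
    "b \<in> E'" "h' b = r" "poly Q b = 0"
proof -
  interpret inclusion: subfield_hom E id by (rule subfield_hom_id)
  have Q0: "Q \<noteq> 0" using Q(2) by (simp add: splits_def)
  obtain m where m: "is_minpoly E h r m" using minpoly_exists[OF Q(1) Q0 r] .
  then have m_over_E: "m \<in> polys_over E" "m \<noteq> 0" "poly (map_poly h m) r = 0"
    by (auto simp: is_minpoly_def)
  have mQ: "m dvd Q" using minpoly_dvd[OF m Q(1) r] .
  obtain b where b: "poly m b = 0"
    using splits_zero_exists[OF splits_dvd[OF Q(2) mQ]] minpoly_degree_pos[OF m] by blast
  obtain m' where m': "is_minpoly E id b m'" using inclusion.minpoly_exists[OF m_over_E(1,2)] b by auto
  define s where "s = m div m'"
  have "m' dvd m" using inclusion.minpoly_dvd[OF m' m_over_E(1)] b by simp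
  then have ms: "m = m' * s" by (simp add: s_def)
  have m'_over_E: "m' \<in> polys_over E" "m' \<noteq> 0" using m' by (auto simp: is_minpoly_def)
  have s_over_E: "s \<in> polys_over E" "s \<noteq> 0"
    unfolding s_def using polys_over_div[OF m'_over_E(1) m_over_E(1)] m_over_E(2) \<open>m' dvd m\<close>
    by (auto simp: dvd_div_eq_0_iff)
  have "degree s < degree m"
    using inclusion.minpoly_degree_pos[OF m'] s_over_E(2) m'_over_E(2) by (simp add: ms degree_mult_eq)
  then have "poly (map_poly h s) r \<noteq> 0" using m s_over_E unfolding is_minpoly_def by fastforce
  moreover have "poly (map_poly h m') r * poly (map_poly h s) r = 0"
    using m_over_E(3) by (simp add: ms map_poly_hom_mult m'_over_E(1) s_over_E(1))
  ultimately have m'r: "poly (map_poly h m') r = 0" by simp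
  show thesis
  proof (rule that)
    show "subfield_hom (adjoin E b) (extend_hom E h b r)"
      by (rule subfield_hom_extend_hom[OF m' m'r])
    show "E \<subseteq> adjoin E b" "b \<in> adjoin E b" by (rule subset_adjoin in_adjoin)+
    show "extend_hom E h b r y = h y" if "y \<in> E" for y using extend_hom_base[OF m' m'r that] .
    show "extend_hom E h b r b = r" by (rule extend_hom_generator[OF m' m'r])
    show "poly Q b = 0" using b mQ by (metis dvdE mult_zero_left poly_mult)
  qed
qed

end

section \<open>Galois groups of splitting fields\<close>

context field_hom
begin

lemma map_poly_map_poly_hom: "map_poly g (map_poly h p) = map_poly (\<lambda>x. g (h x)) p" if "g 0 = 0"
  using that by (simp add: map_poly_map_poly o_def)

lemma map_poly_hom_over_range: "range h \<subseteq> E \<Longrightarrow> map_poly h p \<in> polys_over E"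
  by (auto simp: polys_over_def coeff_map_poly_hom)

lemma subfield_hom_inv_into:
  assumes "field_hom \<psi>"
  shows "subfield_hom (range h) (\<lambda>y. \<psi> (inv_into UNIV h y))"
proof -
  interpret \<psi>: field_hom \<psi> by (rule assms)
  interpret range: subfield "range h" by (rule subfield_range)
  have inv: "inv_into UNIV h (h x) = x" for x by (rule inv_into_f_f) (simp_all add: inj_on_hom)
  show ?thesis
  proof
    show "\<psi> (inv_into UNIV h 1) = 1" using inv[of 1] by simp
    fix x y assume "x \<in> range h" "y \<in> range h"
    then obtain a b where ab: "x = h a" "y = h b" by blast
    show "\<psi> (inv_into UNIV h (x + y)) = \<psi> (inv_into UNIV h x) + \<psi> (inv_into UNIV h y)"
      unfolding ab by (simp add: inv \<psi>.hom_add flip: hom_add)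
    show "\<psi> (inv_into UNIV h (x * y)) = \<psi> (inv_into UNIV h x) * \<psi> (inv_into UNIV h y)"
      unfolding ab by (simp add: inv \<psi>.hom_mult flip: hom_mult)
  qed
qed

lemma maximal_extension:
  assumes \<psi>: "field_hom \<psi>" and Z: "finite Z"
  obtains E \<tau> where "subfield_hom E \<tau>" "range h \<subseteq> E" "\<And>z. \<tau> (h z) = \<psi> z"
    "\<forall>E' \<tau>'. subfield_hom E' \<tau>' \<and> E \<subseteq> E' \<and> (\<forall>y\<in>E. \<tau>' y = \<tau> y) \<longrightarrow> Z \<inter> E' \<subseteq> E"
proof -
  define extends where "extends = (\<lambda>(E, \<tau>). subfield_hom E \<tau> \<and> range h \<subseteq> E \<and> (\<forall>z. \<tau> (h z) = \<psi> z))"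
  have "extends (range h, \<lambda>y. \<psi> (inv_into UNIV h y))"
    unfolding extends_def using subfield_hom_inv_into[OF \<psi>] by (simp add: inj_on_hom)
  moreover have "card (Z \<inter> fst p) < Suc (card Z)" for p
    using card_mono[OF Z, of "Z \<inter> fst p"] by simp
  ultimately obtain p where p: "extends p" "\<And>p'. extends p' \<Longrightarrow> card (Z \<inter> fst p') \<le> card (Z \<inter> fst p)"
    using ex_has_greatest_nat[of extends _ "\<lambda>p. card (Z \<inter> fst p)" "Suc (card Z)"]
    by (metis less_imp_le)
  obtain E \<tau> where p_eq: "p = (E, \<tau>)" by (cases p)
  have E: "subfield_hom E \<tau>" "range h \<subseteq> E" "\<And>z. \<tau> (h z) = \<psi> z"
    using p(1) by (auto simp: extends_def p_eq)
  show thesis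
  proof (rule that[OF E], intro allI impI)
    fix E' \<tau>' assume E': "subfield_hom E' \<tau>' \<and> E \<subseteq> E' \<and> (\<forall>y\<in>E. \<tau>' y = \<tau> y)"
    then have "extends (E', \<tau>')" using E(2,3) by (auto simp: extends_def range_subsetD)
    then have "card (Z \<inter> E') \<le> card (Z \<inter> E)" using p(2)[of "(E', \<tau>')"] by (simp add: p_eq)
    then have "Z \<inter> E = Z \<inter> E'" using E' Z by (intro card_seteq) auto
    then show "Z \<inter> E' \<subseteq> E" by blast
  qed
qed

lemma embedding_onto_zeros:
  assumes \<psi>: "field_hom \<psi>" and Q: "splits (map_poly h Q)"
  obtains E \<tau> where "subfield_hom E \<tau>" "range h \<subseteq> E"
    "\<tau> ` (zeros (map_poly h Q) \<inter> E) = zeros (map_poly \<psi> Q)"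
proof -
  let ?Z = "zeros (map_poly h Q)"
  have fin: "finite ?Z" using Q by (intro poly_roots_finite) (simp add: splits_def)
  obtain E \<tau>
    where E: "subfield_hom E \<tau>" "range h \<subseteq> E" "\<And>z. \<tau> (h z) = \<psi> z"
      and maximal: "\<forall>E' \<tau>'. subfield_hom E' \<tau>' \<and> E \<subseteq> E' \<and> (\<forall>y\<in>E. \<tau>' y = \<tau> y) \<longrightarrow> ?Z \<inter> E' \<subseteq> E"
    by (rule maximal_extension[OF \<psi> fin]) (rule that)
  interpret \<tau>: subfield_hom E \<tau> by (rule E(1))
  have Q_over_E: "map_poly h Q \<in> polys_over E" using E(2) by (rule map_poly_hom_over_range)
  have \<tau>Q: "map_poly \<tau> (map_poly h Q) = map_poly \<psi> Q" by (simp add: map_poly_map_poly_hom E(3))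
  have "\<tau> ` (?Z \<inter> E) \<subseteq> zeros (map_poly \<psi> Q)"
    using \<tau>.poly_map_poly_hom[OF Q_over_E] by (auto simp: \<tau>Q)
  moreover have "y \<in> \<tau> ` (?Z \<inter> E)" if y: "y \<in> zeros (map_poly \<psi> Q)" for y
  proof -
    obtain E' \<tau>' b where E': "subfield_hom E' \<tau>'" "E \<subseteq> E'" "\<And>y. y \<in> E \<Longrightarrow> \<tau>' y = \<tau> y"
      and b: "b \<in> E'" "\<tau>' b = y" "poly (map_poly h Q) b = 0"
      using \<tau>.extend_to_zero[OF Q_over_E Q, of y] y by (auto simp: \<tau>Q)
    then have "b \<in> E" using maximal E' by blast
    then show ?thesis using b E'(3) by auto
  qed
  ultimately have "\<tau> ` (?Z \<inter> E) = zeros (map_poly \<psi> Q)" by blast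
  then show thesis using that E by blast
qed

end

locale splitting_field = field_hom \<phi> for \<phi> :: "'a::field \<Rightarrow> 'b::field" +
  fixes P :: "'a poly"
  assumes P_nonzero: "P \<noteq> 0" and is_splitting_field: "is_splitting_field \<phi> P"
begin

abbreviation Gal :: "('b \<Rightarrow> 'b) set" where
  "Gal \<equiv> carrier (gal_group \<phi>)"

lemma splits_P: "splits (map_poly \<phi> P)"
proof -
  obtain c rs where "map_poly \<phi> P = smult c (\<Prod>r\<leftarrow>rs. [:- r, 1:])"
    using is_splitting_field by (auto simp: is_splitting_field_def)
  moreover from this have "c \<noteq> 0" using P_nonzero map_poly_hom_eq_0_iff[of P] by auto
  ultimately show ?thesis using splits_smult_prod_list_linear by simp
qed

lemma finite_zeros_P: "finite (zeros (map_poly \<phi> P))"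
  using splits_P by (intro poly_roots_finite) (simp add: splits_def)

lemma zeros_generate:
  assumes "subfield S" "range \<phi> \<subseteq> S" "zeros (map_poly \<phi> P) \<subseteq> S"
  shows "S = UNIV"
  using is_splitting_field assms unfolding is_splitting_field_def is_subfield_iff by blast

lemma Gal_iff: "\<sigma> \<in> Gal \<longleftrightarrow> bij \<sigma> \<and> field_hom \<sigma> \<and> (\<forall>z. \<sigma> (\<phi> z) = \<phi> z)"
  by (simp add: gal_group_def is_field_hom_iff)

lemma Gal_id: "id \<in> Gal"
  by (simp add: gal_group_def is_field_hom_def)

lemma Gal_comp: "\<sigma> \<in> Gal \<Longrightarrow> \<tau> \<in> Gal \<Longrightarrow> \<sigma> \<circ> \<tau> \<in> Gal"
  by (simp add: gal_group_def is_field_hom_def bij_comp)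

lemma Gal_inv_apply:
  assumes "\<sigma> \<in> Gal"
  shows "\<sigma> (inv_into UNIV \<sigma> x) = x" "inv_into UNIV \<sigma> (\<sigma> x) = x"
  using assms by (auto simp: Gal_iff bij_is_surj surj_f_inv_f bij_is_inj)

lemma Gal_eq_iff: "\<sigma> \<in> Gal \<Longrightarrow> \<sigma> x = \<sigma> y \<longleftrightarrow> x = y"
  by (metis Gal_inv_apply(2))

lemma Gal_inv:
  assumes "\<sigma> \<in> Gal"
  shows "inv_into UNIV \<sigma> \<in> Gal"
proof -
  interpret \<sigma>: field_hom \<sigma> using assms by (simp add: Gal_iff)
  note inv = Gal_inv_apply[OF assms]
  have "inv_into UNIV \<sigma> (x + y) = inv_into UNIV \<sigma> x + inv_into UNIV \<sigma> y"
    "inv_into UNIV \<sigma> (x * y) = inv_into UNIV \<sigma> x * inv_into UNIV \<sigma> y" for x y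
    by (metis inv \<sigma>.hom_add \<sigma>.hom_mult)+
  moreover have "inv_into UNIV \<sigma> 1 = 1" "inv_into UNIV \<sigma> (\<phi> z) = \<phi> z" for z
    using assms inv(2) by (metis \<sigma>.hom_1 Gal_iff)+
  ultimately show ?thesis
    using assms by (simp add: gal_group_def is_field_hom_def bij_imp_bij_inv)
qed

lemma Gal_zeros:
  assumes "\<sigma> \<in> Gal" "x \<in> zeros (map_poly \<phi> Q)"
  shows "\<sigma> x \<in> zeros (map_poly \<phi> Q)"
proof -
  interpret \<sigma>: field_hom \<sigma> using assms by (simp add: Gal_iff)
  have "map_poly \<sigma> (map_poly \<phi> Q) = map_poly \<phi> Q"
    using assms(1) by (simp add: map_poly_map_poly_hom Gal_iff)
  then show ?thesis using assms(2) \<sigma>.poly_map_poly_hom[of "map_poly \<phi> Q" x] by simp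
qed

lemma endomorphism_in_Gal:
  assumes "field_hom \<tau>" "\<And>z. \<tau> (\<phi> z) = \<phi> z"
  shows "\<tau> \<in> Gal"
proof -
  interpret \<tau>: field_hom \<tau> by fact
  let ?Z = "zeros (map_poly \<phi> P)"
  have inj: "inj \<tau>" by (simp add: \<tau>.inj_on_hom)
  have "map_poly \<tau> (map_poly \<phi> P) = map_poly \<phi> P" by (simp add: map_poly_map_poly_hom assms(2))
  then have "\<tau> ` ?Z \<subseteq> ?Z" using \<tau>.poly_map_poly_hom[of "map_poly \<phi> P"] by auto
  then have "\<tau> ` ?Z = ?Z"
    using inj finite_zeros_P by (metis endo_inj_surj inj_on_subset subset_UNIV)
  then have "?Z \<subseteq> range \<tau>" by blast
  moreover have "range \<phi> \<subseteq> range \<tau>" using assms(2) by (metis image_subsetI rangeI)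
  ultimately have "range \<tau> = UNIV" by (intro zeros_generate \<tau>.subfield_range)
  then show ?thesis using inj assms by (simp add: Gal_iff bij_def)
qed

lemma zero_minpoly:
  assumes E: "subfield E" "range \<phi> \<subseteq> E" and x: "poly (map_poly \<phi> P) x = 0"
  obtains m where "is_minpoly E id x m" "m dvd map_poly \<phi> P"
proof -
  interpret inclusion: subfield_hom E id by (rule subfield.subfield_hom_id[OF E(1)])
  have PE: "map_poly \<phi> P \<in> polys_over E" using E(2) by (rule map_poly_hom_over_range)
  moreover have "map_poly \<phi> P \<noteq> 0" using P_nonzero by (simp add: map_poly_hom_eq_0_iff)
  ultimately obtain m where m: "is_minpoly E id x m"
    using inclusion.minpoly_exists x by auto
  then show thesis using that inclusion.minpoly_dvd[OF m PE] x by simp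
qed

theorem Gal_extend:
  assumes "subfield_hom E \<tau>" "range \<phi> \<subseteq> E" "\<And>z. \<tau> (\<phi> z) = \<phi> z"
  shows "\<exists>\<sigma>\<in>Gal. \<forall>y\<in>E. \<sigma> y = \<tau> y"
  using assms
proof (induction "card (zeros (map_poly \<phi> P) - E)" arbitrary: E \<tau> rule: less_induct)
  case less
  let ?P = "map_poly \<phi> P"
  interpret \<tau>: subfield_hom E \<tau> by (rule less.prems(1))
  interpret inclusion: subfield_hom E id by (rule \<tau>.subfield_hom_id)
  show ?case
  proof (cases "zeros ?P \<subseteq> E")
    case True
    then have "E = UNIV" using zeros_generate \<tau>.subfield_axioms less.prems(2) by blast
    then have "field_hom \<tau>" using \<tau>.subring_hom_axioms
      by (simp add: field_hom_def comm_ring_hom_def)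
    then show ?thesis using endomorphism_in_Gal less.prems(3) by blast
  next
    case False
    then obtain x where x: "poly ?P x = 0" "x \<notin> E" by blast
    obtain m where m: "is_minpoly E id x m" and mP: "m dvd ?P"
      using zero_minpoly[OF \<tau>.subfield_axioms less.prems(2) x(1)] .
    have m_over_E: "m \<in> polys_over E" using m by (simp add: is_minpoly_def)
    have "map_poly \<tau> m dvd map_poly \<tau> ?P"
      by (intro \<tau>.map_poly_hom_dvd m_over_E mP map_poly_hom_over_range less.prems(2))
    also have "map_poly \<tau> ?P = ?P" by (simp add: map_poly_map_poly_hom less.prems(3))
    finally have "splits (map_poly \<tau> m)" by (rule splits_dvd[OF splits_P])
    then obtain r where r: "poly (map_poly \<tau> m) r = 0"
      using splits_zero_exists inclusion.minpoly_degree_pos[OF m] \<tau>.degree_map_poly_hom[OF m_over_E]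
      by metis
    let ?E = "adjoin E x" and ?\<tau> = "extend_hom E \<tau> x r"
    note sub = \<tau>.subset_adjoin[of x] and base = \<tau>.extend_hom_base[OF m r]
    have "card (zeros ?P - ?E) < card (zeros ?P - E)"
      using x sub \<tau>.in_adjoin[of x] finite_zeros_P by (intro psubset_card_mono) auto
    moreover have "range \<phi> \<subseteq> ?E" using sub less.prems(2) by blast
    moreover have "?\<tau> (\<phi> z) = \<phi> z" for z using base less.prems(2,3) by (metis range_subsetD)
    ultimately obtain \<sigma> where "\<sigma> \<in> Gal" "\<forall>y\<in>?E. \<sigma> y = ?\<tau> y"
      using less.hyps \<tau>.subfield_hom_extend_hom[OF m r] by blast
    then show ?thesis using sub base by (metis subsetD)
  qed
qed

lemma Gal_conjugate:
  assumes E: "subfield E" "range \<phi> \<subseteq> E" and m: "is_minpoly E id x m" and y: "poly m y = 0"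
  obtains \<sigma> where "\<sigma> \<in> Gal" "\<And>z. z \<in> E \<Longrightarrow> \<sigma> z = z" "\<sigma> x = y"
proof -
  interpret E: subfield E by (rule E(1))
  interpret inclusion: subfield_hom E id by (rule E.subfield_hom_id)
  have y': "poly (map_poly id m) y = 0" using y by simp
  note hom = inclusion.subfield_hom_extend_hom[OF m y']
    and base = inclusion.extend_hom_base[OF m y']
  have "range \<phi> \<subseteq> adjoin E x" using E(2) E.subset_adjoin by blast
  moreover have "extend_hom E id x y (\<phi> z) = \<phi> z" for z
    using base E(2) by (metis id_apply range_subsetD)
  ultimately obtain \<sigma> where "\<sigma> \<in> Gal" "\<forall>z\<in>adjoin E x. \<sigma> z = extend_hom E id x y z"
    using Gal_extend[OF hom] by blast
  then show thesis
    using that base inclusion.extend_hom_generator[OF m y'] E.subset_adjoin E.in_adjoin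
    by (metis id_apply subsetD)
qed

text \<open>If \<open>x = q(\<alpha>)\<close> with \<open>deg q\<close> smaller than the degree of the minimal polynomial of \<open>\<alpha>\<close>, then
  \<open>q - x\<close> vanishes at all conjugates of \<open>\<alpha>\<close>, so \<open>q = x\<close>.\<close>

lemma Gal_fixed_in_adjoin:
  assumes E: "subfield E" "range \<phi> \<subseteq> E"
    and fixed: "\<And>\<sigma>. \<sigma> \<in> Gal \<Longrightarrow> (\<And>y. y \<in> E \<Longrightarrow> \<sigma> y = y) \<Longrightarrow> \<sigma> x = x"
    and m: "is_minpoly E id \<alpha> m" "splits_separably m" and x: "x \<in> adjoin E \<alpha>"
  shows "x \<in> E"
proof -
  interpret E: subfield E by (rule E(1))
  interpret inclusion: subfield_hom E id by (rule E.subfield_hom_id)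
  have m_over_E: "m \<in> polys_over E" "m \<noteq> 0" "poly m \<alpha> = 0" using m(1) by (auto simp: is_minpoly_def)
  obtain q0 where q0: "q0 \<in> polys_over E" "x = poly q0 \<alpha>" using x by (auto simp: adjoin_def)
  define q where "q = q0 mod m"
  have q_over_E: "q \<in> polys_over E" unfolding q_def by (rule E.polys_over_mod[OF m_over_E(1) q0(1)])
  have qx: "x = poly q \<alpha>" using q0(2) poly_mod_at_zero[OF m_over_E(3)] by (simp add: q_def)
  have "zeros m \<subseteq> zeros (q - [:x:])"
  proof
    fix y assume "y \<in> zeros m"
    then obtain \<sigma> where \<sigma>: "\<sigma> \<in> Gal" "\<And>z. z \<in> E \<Longrightarrow> \<sigma> z = z" "\<sigma> \<alpha> = y"
      using Gal_conjugate[OF E m(1)] by auto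
    interpret \<sigma>: field_hom \<sigma> using \<sigma>(1) by (simp add: Gal_iff)
    have "map_poly \<sigma> q = q"
      by (rule poly_eqI) (simp add: \<sigma>.coeff_map_poly_hom \<sigma>(2) coeff_polys_over[OF q_over_E])
    then have "poly q y = \<sigma> x" using \<sigma>.poly_map_poly_hom[of q \<alpha>] \<sigma>(3) qx by simp
    then show "y \<in> zeros (q - [:x:])" using fixed \<sigma>(1,2) by simp
  qed
  moreover have "degree (q - [:x:]) < degree m"
    using degree_mod_less[OF m_over_E(2), of q0] inclusion.minpoly_degree_pos[OF m(1)]
    by (intro degree_diff_less) (auto simp: q_def)
  ultimately have "q - [:x:] = 0"
    using card_poly_roots_bound[of "q - [:x:]"]
      card_mono[OF poly_roots_finite, of "q - [:x:]" "zeros m"] m(2)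
    unfolding splits_separably_def by fastforce
  then show ?thesis using q_over_E by (simp add: E.polys_over_pCons_iff)
qed

end

locale separable_splitting_field = splitting_field +
  assumes splits_separably_P: "splits_separably (map_poly \<phi> P)"
begin

theorem Gal_fixed_field:
  assumes "subfield E" "range \<phi> \<subseteq> E" "\<And>\<sigma>. \<sigma> \<in> Gal \<Longrightarrow> (\<And>y. y \<in> E \<Longrightarrow> \<sigma> y = y) \<Longrightarrow> \<sigma> x = x"
  shows "x \<in> E"
  using assms
proof (induction "card (zeros (map_poly \<phi> P) - E)" arbitrary: E rule: less_induct)
  case less
  let ?P = "map_poly \<phi> P"
  interpret E: subfield E by (rule less.prems(1))
  show ?case
  proof (cases "zeros ?P \<subseteq> E")
    case True
    then show ?thesis using zeros_generate less.prems(1,2) by blast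
  next
    case False
    then obtain \<alpha> where \<alpha>: "poly ?P \<alpha> = 0" "\<alpha> \<notin> E" by blast
    obtain m where m: "is_minpoly E id \<alpha> m" "m dvd ?P"
      using zero_minpoly[OF less.prems(1,2) \<alpha>(1)] .
    have "x \<in> adjoin E \<alpha>"
    proof (rule less.hyps)
      show "card (zeros ?P - adjoin E \<alpha>) < card (zeros ?P - E)"
        using \<alpha> E.subset_adjoin E.in_adjoin finite_zeros_P by (intro psubset_card_mono) auto
      show "subfield (adjoin E \<alpha>)" by (rule E.subfield_adjoin[OF m(1)])
    qed (use less.prems(2,3) E.subset_adjoin in blast)+
    then show ?thesis
      using Gal_fixed_in_adjoin[OF less.prems(1,2) _ m(1)
          splits_separably_dvd[OF splits_separably_P m(2)]]
        less.prems(3) by blast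
  qed
qed

corollary Gal_invariant_prod:
  assumes E: "subfield E" "range \<phi> \<subseteq> E" and B: "finite B"
    and inv: "\<And>\<sigma>. \<sigma> \<in> Gal \<Longrightarrow> (\<And>y. y \<in> E \<Longrightarrow> \<sigma> y = y) \<Longrightarrow> \<sigma> ` B \<subseteq> B"
  shows "(\<Prod>b\<in>B. [:- b, 1:]) \<in> polys_over E"
  unfolding polys_over_def
proof (rule CollectI, rule allI, rule Gal_fixed_field[OF E])
  fix i \<sigma> assume \<sigma>: "\<sigma> \<in> Gal" "\<And>y. y \<in> E \<Longrightarrow> \<sigma> y = y"
  interpret \<sigma>: field_hom \<sigma> using \<sigma>(1) by (simp add: Gal_iff)
  have "\<sigma> ` B = B" using inv[OF \<sigma>] B by (intro endo_inj_surj) (simp_all add: \<sigma>.inj_on_hom)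
  then have "map_poly \<sigma> (\<Prod>b\<in>B. [:- b, 1:]) = (\<Prod>b\<in>B. [:- b, 1:])"
    by (simp add: \<sigma>.map_poly_hom_prod_linear)
  then show "\<sigma> (coeff (\<Prod>b\<in>B. [:- b, 1:]) i) = coeff (\<Prod>b\<in>B. [:- b, 1:]) i"
    by (metis \<sigma>.coeff_map_poly_hom)
qed

lemma Gal_swaps_two_zeros:
  assumes E: "subfield E" "range \<phi> \<subseteq> E" and ab: "zeros (map_poly \<phi> Q) - E = {a, b}" "a \<noteq> b"
  obtains \<sigma> where "\<sigma> \<in> Gal" "\<And>y. y \<in> E \<Longrightarrow> \<sigma> y = y" "\<sigma> a = b" "\<sigma> b = a"
proof -
  have moves: "\<sigma> x \<in> {a, b}" if \<sigma>: "\<sigma> \<in> Gal" "\<And>y. y \<in> E \<Longrightarrow> \<sigma> y = y" and "x \<in> {a, b}" for \<sigma> x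
  proof -
    have x: "x \<in> zeros (map_poly \<phi> Q)" "x \<notin> E" using ab(1) that(3) by blast+
    have "\<sigma> x \<notin> E" using \<sigma>(2)[of "\<sigma> x"] Gal_eq_iff[OF \<sigma>(1)] x(2) by auto
    then show ?thesis using Gal_zeros[OF \<sigma>(1) x(1)] ab(1) by blast
  qed
  have "a \<notin> E" using ab(1) by blast
  then obtain \<sigma> where \<sigma>: "\<sigma> \<in> Gal" "\<And>y. y \<in> E \<Longrightarrow> \<sigma> y = y" "\<sigma> a \<noteq> a"
    using Gal_fixed_field[OF E] by blast
  then have a: "\<sigma> a = b" using moves[of \<sigma> a] by simp
  moreover have "\<sigma> b \<noteq> b" using Gal_eq_iff[OF \<sigma>(1), of b a] a ab(2) by simp
  then have "\<sigma> b = a" using moves[OF \<sigma>(1,2), of b] by simp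
  ultimately show thesis using that \<sigma> by blast
qed

end

section \<open>Rational function fields\<close>

abbreviation peval :: "('k::comm_ring_1 \<Rightarrow> 'b::comm_ring_1) \<Rightarrow> 'k poly \<Rightarrow> 'b \<Rightarrow> 'b" where
  "peval h p y \<equiv> poly (map_poly h p) y"

definition fract_eval :: "('k::field \<Rightarrow> 'b::field) \<Rightarrow> 'b \<Rightarrow> 'k poly fract \<Rightarrow> 'b" where
  "fract_eval h y z = (SOME w. \<exists>p q. q \<noteq> 0 \<and> z = Fract p q \<and> w = peval h p y / peval h q y)"

lemma (in comm_ring_hom) peval_pcompose: "peval h (pcompose p q) y = peval h p (peval h q y)"
  by (simp add: map_poly_hom_pcompose poly_pcompose)

lemma (in comm_ring_hom) comm_ring_hom_peval: "comm_ring_hom (\<lambda>p. peval h p y)"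
  by unfold_locales (simp_all add: map_poly_hom_add map_poly_hom_mult)

lemma (in comm_ring_hom) hom_peval:
  assumes "g 0 = 0"
  shows "h (peval g p y) = peval (\<lambda>a. h (g a)) p (h y)"
  using poly_map_poly_hom[of "map_poly g p" y] assms by (simp add: map_poly_map_poly o_def)

locale transcendental_element = field_hom \<kappa> for \<kappa> :: "'k::field \<Rightarrow> 'b::field" +
  fixes \<beta> :: 'b
  assumes transcendental: "p \<noteq> 0 \<Longrightarrow> peval \<kappa> p \<beta> \<noteq> 0"
begin

abbreviation value_at :: "'k poly \<Rightarrow> 'b" where
  "value_at p \<equiv> peval \<kappa> p \<beta>"

abbreviation simple_extension :: "'b set" where
  "simple_extension \<equiv> range (fract_eval \<kappa> \<beta>)"

sublocale value_at: comm_ring_hom value_at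
  by (rule comm_ring_hom_peval)

sublocale value_at: inj_comm_ring_hom value_at
  by unfold_locales (use transcendental in auto)

lemma fract_eval_Fract:
  assumes q: "q \<noteq> 0"
  shows "fract_eval \<kappa> \<beta> (Fract p q) = value_at p / value_at q"
  unfolding fract_eval_def
proof (rule some_equality)
  show "\<exists>p' q'. q' \<noteq> 0 \<and> Fract p q = Fract p' q' \<and>
      value_at p / value_at q = value_at p' / value_at q'"
    using q by blast
  fix w assume "\<exists>p' q'. q' \<noteq> 0 \<and> Fract p q = Fract p' q' \<and> w = value_at p' / value_at q'"
  then obtain p' q' where w: "q' \<noteq> 0" "Fract p q = Fract p' q'" "w = value_at p' / value_at q'"
    by blast
  have "p * q' = p' * q" using w(1,2) q by (simp add: eq_fract)
  then have "value_at p * value_at q' = value_at p' * value_at q" by (metis value_at.hom_mult)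
  then show "w = value_at p / value_at q" using q w by (simp add: transcendental frac_eq_eq)
qed

lemma fract_eval_poly: "fract_eval \<kappa> \<beta> (Fract p 1) = value_at p"
  by (simp add: fract_eval_Fract)

lemma fract_eval_X: "fract_eval \<kappa> \<beta> (Fract [:0, 1:] 1) = \<beta>"
  by (simp add: fract_eval_poly map_poly_hom_X)

lemma field_hom_fract_eval: "field_hom (fract_eval \<kappa> \<beta>)"
proof -
  have "fract_eval \<kappa> \<beta> 1 = 1" by (simp add: One_fract_def fract_eval_poly)
  moreover have "fract_eval \<kappa> \<beta> (a + b) = fract_eval \<kappa> \<beta> a + fract_eval \<kappa> \<beta> b
     \<and> fract_eval \<kappa> \<beta> (a * b) = fract_eval \<kappa> \<beta> a * fract_eval \<kappa> \<beta> b" for a b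
    by (cases a; cases b)
      (auto simp: fract_eval_Fract map_poly_hom_mult map_poly_hom_add transcendental field_simps)
  ultimately have "is_field_hom (fract_eval \<kappa> \<beta>)" by (simp add: is_field_hom_def)
  then show ?thesis by (simp add: is_field_hom_iff)
qed

sublocale fract_eval: field_hom "fract_eval \<kappa> \<beta>"
  by (rule field_hom_fract_eval)

lemma map_poly_fract_eval_gal_poly:
  "map_poly (fract_eval \<kappa> \<beta>) (gal_poly f n) = map_poly \<kappa> (poly_iter f n) - [:\<beta>:]"
proof -
  have "map_poly (fract_eval \<kappa> \<beta>) (map_poly (\<lambda>c. Fract [:c:] 1) (poly_iter f n))
      = map_poly \<kappa> (poly_iter f n)"
    by (simp add: map_poly_map_poly o_def fract_eval_poly map_poly_hom_const flip: Zero_fract_def)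
  then show ?thesis
    by (simp add: gal_poly_def fract_eval.map_poly_hom_diff fract_eval.map_poly_hom_const
        fract_eval_X)
qed

end

lemma field_hom_fract_decomp:
  fixes \<phi> :: "'k::field poly fract \<Rightarrow> 'b::field"
  assumes "field_hom \<phi>"
  defines "\<kappa> \<equiv> \<lambda>a. \<phi> (Fract [:a:] 1)" and "T \<equiv> \<phi> (Fract [:0, 1:] 1)"
  shows "transcendental_element \<kappa> T" "\<phi> = fract_eval \<kappa> T"
proof -
  interpret \<phi>: field_hom \<phi> by (rule assms(1))
  have "is_field_hom \<kappa>"
    unfolding is_field_hom_def \<kappa>_def
    by (simp add: mult.commute flip: One_fract_def one_pCons \<phi>.hom_add \<phi>.hom_mult)
  then interpret \<kappa>: field_hom \<kappa> by (simp add: is_field_hom_iff)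
  have p: "\<phi> (Fract p 1) = peval \<kappa> p T" for p
  proof (induction p)
    case 0
    show ?case by (simp flip: Zero_fract_def)
  next
    case (pCons a p)
    have "Fract (pCons a p) 1 = Fract [:a:] 1 + Fract [:0, 1:] 1 * Fract p 1" by simp
    then have "\<phi> (Fract (pCons a p) 1) = \<kappa> a + T * peval \<kappa> p T"
      using pCons.IH by (simp add: \<phi>.hom_add \<phi>.hom_mult \<kappa>_def T_def del: mult_fract add_fract)
    then show ?case by (simp add: \<kappa>.map_poly_hom_pCons)
  qed
  show "transcendental_element \<kappa> T"
  proof
    fix p :: "'k poly" assume "p \<noteq> 0"
    then have "Fract p 1 \<noteq> 0" by (simp add: Zero_fract_def eq_fract)
    then show "peval \<kappa> p T \<noteq> 0" by (simp flip: p add: \<phi>.hom_eq_0_iff)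
  qed
  then interpret T: transcendental_element \<kappa> T .
  show "\<phi> = fract_eval \<kappa> T"
  proof
    fix z :: "'k poly fract"
    obtain a b where z: "z = Fract a b" "b \<noteq> 0" by (cases z)
    then have "z = Fract a 1 / Fract b 1" by simp
    then have "\<phi> z = peval \<kappa> a T / peval \<kappa> b T" by (simp only: \<phi>.hom_divide p)
    then show "\<phi> z = fract_eval \<kappa> T z" by (simp only: z T.fract_eval_Fract[OF z(2)])
  qed
qed

section \<open>Polynomials with generic critical orbits\<close>

lemma alg_closed_splits:
  fixes p :: "'k::field poly"
  assumes "alg_closed_field TYPE('k)" "p \<noteq> 0"
  shows "splits p"
  using assms by (auto simp: alg_closed_field_def splits_def Suc_le_eq)

lemma degree_minus_const [simp]:
  fixes p :: "'a::ab_group_add poly"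
  shows "degree (p - [:c:]) = degree p"
  by (cases p) (simp add: degree_pCons_eq_if)

lemma pcompose_dvd_pcompose: "p dvd q \<Longrightarrow> pcompose p r dvd pcompose q r"
  by (auto simp: dvd_def pcompose_mult)

lemma power_linear_dvd_pderiv:
  fixes p :: "'a::field poly"
  assumes "[:- a, 1:] ^ Suc n dvd p"
  shows "[:- a, 1:] ^ n dvd pderiv p"
proof -
  obtain q where "p = [:- a, 1:] ^ Suc n * q" using assms by (auto simp: dvd_def)
  then show ?thesis by (simp only: lemma_order_pderiv1) (simp add: dvd_smult del: mult_pCons_left)
qed

lemma separable_poly_no_double_zero:
  assumes "separable_poly q"
  shows "\<not> [:- a, 1:] ^ 2 dvd q"
proof
  assume "[:- a, 1:] ^ 2 dvd q"
  then have "[:- a, 1:] dvd q" "[:- a, 1:] dvd pderiv q"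
    by (simp_all add: square_linear_dvd_iff poly_eq_0_iff_dvd)
  then have "is_unit [:- a, 1:]"
    using assms unfolding separable_poly_def by (meson coprime_common_divisor)
  then show False by (simp add: is_unit_poly_iff)
qed

lemma degree_pderiv_of_nat_nonzero:
  fixes g :: "'k::field poly"
  assumes "of_nat (degree g) \<noteq> (0 :: 'k)"
  shows "degree (pderiv g) = degree g - 1"
proof (rule antisym)
  show "degree (pderiv g) \<le> degree g - 1"
    by (rule degree_le) (auto simp: coeff_pderiv coeff_eq_0)
  obtain n where n: "degree g = Suc n" using assms by (cases "degree g") auto
  then have "g \<noteq> 0" by auto
  then have "coeff (pderiv g) n \<noteq> 0"
    using assms by (simp add: coeff_pderiv n[symmetric] del: of_nat_Suc)
  then show "degree g - 1 \<le> degree (pderiv g)" by (simp add: le_degree n)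
qed

lemma order_pcompose_unramified:
  fixes g h :: "'k::field poly"
  assumes h: "h - [:poly h w:] \<noteq> 0" and g: "poly (pderiv g) (poly h w) \<noteq> 0"
  shows "order w (pcompose g h - [:poly g (poly h w):]) = order w (h - [:poly h w:])"
proof -
  define v where "v = poly h w"
  have "poly (g - [:poly g v:]) v = 0" by simp
  then obtain s where s: "g - [:poly g v:] = [:- v, 1:] * s" by (rule linear_factorE)
  have "pderiv g = pderiv ([:- v, 1:] * s)" unfolding s[symmetric] by (simp add: pderiv_diff)
  then have "poly (pderiv g) v = poly s v" unfolding pderiv_mult by (simp add: pderiv_pCons)
  then have sw: "poly (pcompose s h) w \<noteq> 0" using g by (simp add: poly_pcompose v_def)
  have "pcompose g h - [:poly g v:] = pcompose (g - [:poly g v:]) h" by (simp add: pcompose_diff)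
  also have "\<dots> = (h - [:v:]) * pcompose s h" unfolding s pcompose_mult by (simp add: pcompose_pCons)
  also have "order w \<dots> = order w (h - [:v:])"
    using h sw by (subst order_mult) (auto simp: v_def order_0I)
  finally show ?thesis by (simp add: v_def)
qed

lemma minus_const_dvd_pcompose:
  fixes g h :: "'a::comm_ring_1 poly"
  assumes "[:- v, 1:] dvd g"
  shows "h - [:v:] dvd pcompose g h"
proof -
  have "pcompose [:- v, 1:] h = h - [:v:]" by (simp add: pcompose_pCons)
  then show ?thesis using pcompose_dvd_pcompose[OF assms, of h] by simp
qed

lemma poly_iter_0 [simp]: "poly_iter f 0 = [:0, 1:]"
  by (simp add: poly_iter_def)

lemma poly_iter_Suc: "poly_iter f (Suc n) = pcompose f (poly_iter f n)"
  by (simp add: poly_iter_def)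

lemma poly_iter_Suc_right: "poly_iter f (Suc n) = pcompose (poly_iter f n) f"
proof (induction n)
  case 0
  then show ?case by (simp add: poly_iter_Suc pcompose_pCons)
next
  case (Suc n)
  then show ?case by (metis poly_iter_Suc pcompose_assoc)
qed

lemma poly_poly_iter: "poly (poly_iter f n) x = (poly f ^^ n) x"
  by (induction n) (auto simp: poly_iter_Suc poly_pcompose)

lemma degree_poly_iter:
  fixes f :: "'a::idom poly"
  shows "degree (poly_iter f n) = degree f ^ n"
  by (induction n) (auto simp: poly_iter_Suc degree_pcompose)

lemma (in comm_ring_hom) peval_poly_iter: "peval h (poly_iter f n) x = (peval h f ^^ n) x"
  by (induction n) (auto simp: poly_iter_Suc peval_pcompose map_poly_hom_X)

lemma critical_point_of_iterate:
  fixes f :: "'k::field poly"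
  assumes "poly (pderiv (poly_iter f n)) x = 0"
  shows "\<exists>j<n. (poly f ^^ j) x \<in> critical_points f"
  using assms
proof (induction n)
  case 0
  then show ?case by (simp add: pderiv_pCons)
next
  case (Suc n)
  then have "poly (pderiv f) ((poly f ^^ n) x) = 0 \<or> poly (pderiv (poly_iter f n)) x = 0"
    by (simp add: poly_iter_Suc pderiv_pcompose poly_pcompose poly_poly_iter)
  then show ?case using Suc.IH by (auto simp: critical_points_def less_Suc_eq)
qed

locale generic_critical_orbits =
  fixes f :: "'k::field poly" and d N :: nat
  assumes alg_closed: "alg_closed_field TYPE('k)"
    and d_ge_2: "d \<ge> 2" and N_ge_1: "N \<ge> 1"
    and not_quadratic_char_2: "\<not> (d = 2 \<and> CHAR('k) = 2)"
    and f_in_H: "f \<in> H_set d N TYPE('k)"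
begin

lemma degree_f: "degree f = d"
  using f_in_H by (simp add: H_set_def)

lemma f_minus_const_nonzero: "f - [:c:] \<noteq> 0"
proof
  assume "f - [:c:] = 0"
  then have "degree (f - [:c:]) = 0" by (simp only: degree_0)
  then show False using degree_f d_ge_2 by simp
qed

lemma zero_exists:
  fixes p :: "'k poly"
  assumes "degree p \<ge> 1"
  obtains x where "poly p x = 0"
  using assms alg_closed by (auto simp: alg_closed_field_def)

lemma critical_orbits_disjoint:
  assumes "w \<in> critical_points f" "w' \<in> critical_points f" "m \<le> N" "n \<le> N"
    "(poly f ^^ n) w = (poly f ^^ m) w'"
  shows "n = m \<and> w = w'"
  using f_in_H assms unfolding H_set_def by blast

lemma no_triple_point: "\<not> [:- b, 1:] ^ 3 dvd f - [:c:]"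
proof (cases "CHAR('k) = 2")
  case True
  then show ?thesis using f_in_H by (simp add: H_set_def)
next
  case False
  then have "separable_poly (pderiv f)" using f_in_H by (simp add: H_set_def)
  then have "\<not> [:- b, 1:] ^ 2 dvd pderiv (f - [:c:])"
    using separable_poly_no_double_zero by (simp add: pderiv_diff)
  then show ?thesis using power_linear_dvd_pderiv[of b 2 "f - [:c:]"]
    by (auto simp: numeral_3_eq_3 numeral_2_eq_2)
qed

text \<open>The zeros of \<open>h - v\<close> are critical points with the same image, so there is only one.\<close>

lemma ramified_point_of_decomposition:
  assumes f: "f = pcompose g h" and v: "poly (pderiv g) v = 0" and h: "degree h \<ge> 1"
  obtains a where "[:- a, 1:] ^ degree h dvd pderiv f" "[:- a, 1:] ^ degree h dvd f - [:poly g v:]"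
proof -
  define u where "u = h - [:v:]"
  have deg: "degree u = degree h" by (simp add: u_def)
  have "[:- v, 1:] dvd pderiv g" "[:- v, 1:] dvd g - [:poly g v:]"
    using v by (simp_all flip: poly_eq_0_iff_dvd)
  then have u_dvd: "u dvd pderiv f" "u dvd f - [:poly g v:]"
    using minus_const_dvd_pcompose[of v "pderiv g" h]
      minus_const_dvd_pcompose[of v "g - [:poly g v:]" h]
    by (simp_all add: f u_def pderiv_pcompose pcompose_diff dvd_mult2)
  obtain a where a: "poly u a = 0" using zero_exists[of u] h deg by auto
  have "x = a" if x: "poly u x = 0" for x
  proof -
    have "x \<in> critical_points f" "a \<in> critical_points f"
      using x a u_dvd(1) by (auto simp: critical_points_def dvd_def)
    moreover have "poly f x = poly f a" using x a by (simp add: f poly_pcompose u_def)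
    ultimately show ?thesis using critical_orbits_disjoint[of x a 1 1] N_ge_1 by simp
  qed
  then have "zeros u = {a}" using a by blast
  moreover have "splits u" using deg h by (intro alg_closed_splits[OF alg_closed]) auto
  ultimately have "order a u = degree h" using splits_sum_order[of u] deg by simp
  then have "[:- a, 1:] ^ degree h dvd u" using order_1[of a u] by simp
  then show thesis using that u_dvd dvd_trans by blast
qed

lemma indecomposable: "indecomposable_poly f"
proof (cases "CHAR('k) dvd d")
  case True
  then show ?thesis using f_in_H by (simp add: H_set_def)
next
  case False
  show ?thesis
    unfolding indecomposable_poly_def
  proof (intro allI impI, rule ccontr)
    fix g h assume fgh: "f = pcompose g h" and both_not_1: "\<not> (degree g = 1 \<or> degree h = 1)"
    have d: "d = degree g * degree h"
      using degree_f degree_pcompose[of g h] by (simp add: fgh)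
    then have "degree g \<noteq> 0" "degree h \<noteq> 0" using d_ge_2
      by (metis mult_0 mult_0_right not_numeral_le_zero)+
    then have deg_g: "degree g \<ge> 2" and deg_h: "degree h \<ge> 2" using both_not_1 by linarith+
    have "of_nat (degree g) \<noteq> (0::'k)"
      using False d by (metis dvd_mult2 of_nat_eq_0_iff_char_dvd)
    then have "degree (pderiv g) \<ge> 1" using degree_pderiv_of_nat_nonzero[of g] deg_g by simp
    then obtain v where v: "poly (pderiv g) v = 0" by (rule zero_exists)
    obtain a
      where a: "[:- a, 1:] ^ degree h dvd pderiv f" "[:- a, 1:] ^ degree h dvd f - [:poly g v:]"
      using ramified_point_of_decomposition[OF fgh v] deg_h by auto
    consider (two) "degree h = 2" | (large) "degree h \<ge> 3" using deg_h by linarith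
    then show False
    proof cases
      case two
      then have "CHAR('k) \<noteq> 2" using False d by auto
      then have "separable_poly (pderiv f)" using f_in_H by (simp add: H_set_def)
      then show False using separable_poly_no_double_zero[of "pderiv f" a] a(1) two by simp
    next
      case large
      then show False using no_triple_point[of a] a(2) by (meson dvd_trans le_imp_power_dvd)
    qed
  qed
qed

lemma degree_pderiv_pos: "degree (pderiv f) \<ge> 1"
proof (cases "CHAR('k) dvd d")
  case True
  have "d \<noteq> 2"
  proof
    assume "d = 2"
    then have "CHAR('k) dvd 2" "CHAR('k) \<noteq> 2" using True not_quadratic_char_2 by auto
    moreover have "CHAR('k) \<le> 2" using \<open>CHAR('k) dvd 2\<close> by (simp add: dvd_imp_le)
    moreover have "CHAR('k) \<noteq> 0" using \<open>CHAR('k) dvd 2\<close> by (metis dvd_0_left_iff zero_neq_numeral)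
    ultimately show False using CHAR_not_1[where ?'a = 'k] by linarith
  qed
  then show ?thesis using f_in_H True d_ge_2 by (simp add: H_set_def)
next
  case False
  then have "of_nat (degree f) \<noteq> (0::'k)" by (simp add: degree_f of_nat_eq_0_iff_char_dvd)
  then show ?thesis using degree_pderiv_of_nat_nonzero[of f] degree_f d_ge_2 by simp
qed

lemma critical_point_exists: obtains w where "w \<in> critical_points f"
  using zero_exists[OF degree_pderiv_pos] unfolding critical_points_def by blast

lemma pderiv_poly_iter_nonzero: "pderiv (poly_iter f n) \<noteq> 0"
proof (induction n)
  case 0
  then show ?case by (simp add: pderiv_pCons)
next
  case (Suc n)
  have "degree (poly_iter f n) \<noteq> 0" using d_ge_2 by (simp add: degree_poly_iter degree_f)
  then have "pcompose (pderiv f) (poly_iter f n) \<noteq> 0"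
    using degree_pderiv_pos by (auto simp: pcompose_eq_0_iff)
  then show ?case using Suc by (simp add: poly_iter_Suc pderiv_pcompose)
qed

lemma order_at_critical_point:
  assumes "w \<in> critical_points f"
  shows "order w (f - [:poly f w:]) = 2"
proof -
  note nz = f_minus_const_nonzero[of "poly f w"]
  have "[:- w, 1:] ^ 2 dvd f - [:poly f w:]"
    using assms by (simp add: square_linear_dvd_iff critical_points_def pderiv_diff)
  then have "2 \<le> order w (f - [:poly f w:])" using nz by (simp add: order_divides)
  moreover have "\<not> 3 \<le> order w (f - [:poly f w:])"
    using no_triple_point[of w "poly f w"] nz by (simp add: order_divides)
  ultimately show ?thesis by linarith
qed

lemma iterate_order_at_critical_point:
  assumes w: "w \<in> critical_points f" and n: "1 \<le> n" "n \<le> N"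
  shows "order w (poly_iter f n - [:poly (poly_iter f n) w:]) = 2"
proof -
  obtain n' where n': "n = Suc n'" using n(1) by (cases n) auto
  have "poly (pderiv (poly_iter f n')) (poly f w) \<noteq> 0"
  proof
    assume "poly (pderiv (poly_iter f n')) (poly f w) = 0"
    then obtain j where j: "j < n'" "(poly f ^^ j) (poly f w) \<in> critical_points f"
      using critical_point_of_iterate by blast
    have "(poly f ^^ Suc j) w = (poly f ^^ 0) ((poly f ^^ j) (poly f w))"
      by (simp add: funpow_swap1)
    then show False using critical_orbits_disjoint[OF w j(2), of 0 "Suc j"] j(1) n' n by simp
  qed
  then show ?thesis
    using order_pcompose_unramified[OF f_minus_const_nonzero,
      where g = "poly_iter f n'"] order_at_critical_point[OF w]
    by (simp add: n' poly_iter_Suc_right poly_pcompose)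
qed

lemma iterate_simple_away_from_critical_point:
  assumes w: "w \<in> critical_points f" and n: "n \<le> N"
    and x: "poly (poly_iter f n) x = poly (poly_iter f n) w" "x \<noteq> w"
  shows "poly (pderiv (poly_iter f n)) x \<noteq> 0"
proof
  assume "poly (pderiv (poly_iter f n)) x = 0"
  then obtain j where j: "j < n" "(poly f ^^ j) x \<in> critical_points f"
    using critical_point_of_iterate by blast
  have "(poly f ^^ (n - j)) ((poly f ^^ j) x) = (poly f ^^ n) x"
    using j(1) by (simp flip: funpow_add[THEN fun_cong, unfolded o_apply])
  also have "\<dots> = (poly f ^^ n) w" using x(1) by (simp add: poly_poly_iter)
  finally have "n - j = n \<and> (poly f ^^ j) x = w"
    using critical_orbits_disjoint[OF j(2) w, of n "n - j"] n by simp
  then show False using j(1) x(2) by (cases j) auto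
qed

end

section \<open>Zeros in a field of Laurent series\<close>

interpretation fps_const: comm_ring_hom "fps_const :: 'a::comm_ring_1 \<Rightarrow> 'a fps"
  by unfold_locales (simp_all flip: fps_const_add fps_const_mult)

interpretation fps_nth_0: comm_ring_hom "\<lambda>Y. (Y :: 'a::comm_ring_1 fps) $ 0"
  by unfold_locales (simp_all add: fps_mult_nth_0)

interpretation fps_to_fls: comm_ring_hom "fps_to_fls :: 'a::comm_ring_1 fps \<Rightarrow> 'a fls"
  by unfold_locales (simp_all add: fls_times_fps_to_fls)

interpretation fls_const: field_hom "fls_const :: 'a::field \<Rightarrow> 'a fls"
  by unfold_locales (simp_all add: fls_plus_const fls_const_mult_const)

lemma peval_fps_const_nth_0: "peval fps_const p Y $ 0 = poly p (Y $ 0)"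
  using fps_nth_0.poly_map_poly_hom[of "map_poly fps_const p" Y]
  by (simp add: map_poly_map_poly o_def)

lemma peval_fls_const_fps_to_fls:
  fixes p :: "'a::field poly"
  shows "peval fls_const p (fps_to_fls Y) = fps_to_fls (peval fps_const p Y)"
  using fps_to_fls.poly_map_poly_hom[of "map_poly fps_const p" Y]
  by (simp add: map_poly_map_poly o_def)

lemma peval_fps_const_shift:
  fixes p :: "'a::field poly"
  assumes "U $ 0 = 0"
  shows "peval fps_const p (fps_const r + U) = fps_of_poly (pcompose p [:r, 1:]) oo U"
proof -
  have "peval fps_const q U = fps_of_poly q oo U" for q
    by (induction q)
      (simp_all add: assms fps_const.map_poly_hom_pCons fps_of_poly_pCons fps_compose_add_distrib
        fps_compose_mult_distrib mult.commute)
  from this[of "pcompose p [:r, 1:]"] show ?thesis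
    by (simp add: fps_const.peval_pcompose fps_const.map_poly_hom_pCons)
qed

lemma transcendental_fls_X_plus_const:
  fixes c :: "'a::field"
  shows "transcendental_element fls_const (fls_const c + fls_X)"
proof
  fix p :: "'a poly" assume "p \<noteq> 0"
  then have "pcompose p [:c, 1:] \<noteq> 0" by (simp add: pcompose_eq_0_iff)
  moreover have "peval fls_const p (fps_to_fls (fps_const c + fps_X))
    = fps_to_fls (fps_of_poly (pcompose p [:c, 1:]))"
    using peval_fps_const_shift[of fps_X p c] by (simp only: peval_fls_const_fps_to_fls) simp
  ultimately show "peval fls_const p (fls_const c + fls_X) \<noteq> 0"
    by (simp add: fls_plus_const fps_to_fls_eq_0_iff)
qed

lemma ex1_fps_zero_lift:
  fixes F :: "'a::field poly"
  assumes r: "poly F r = c" "poly (pderiv F) r \<noteq> 0"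
  shows "\<exists>!Y. Y $ 0 = r \<and> peval fps_const F Y = fps_const c + fps_X"
proof -
  define G where "G = fps_of_poly (pcompose F [:r, 1:] - [:c:])"
  have G0: "G $ 0 = 0" using r(1) by (simp add: G_def pcompose_coeff_0)
  have "coeff (pcompose F [:r, 1:]) 1 = poly (pderiv (pcompose F [:r, 1:])) 0"
    by (simp add: poly_0_coeff_0 coeff_pderiv)
  also have "\<dots> = poly (pderiv F) r" by (simp add: pderiv_pcompose poly_pcompose pderiv_pCons)
  finally have G1: "G $ 1 \<noteq> 0" using r(2) by (simp add: G_def)
  have solves: "peval fps_const F (fps_const r + U) = fps_const c + fps_X \<longleftrightarrow> G oo U = fps_X"
    if U: "U $ 0 = 0" for U
  proof -
    have "fps_of_poly (pcompose F [:r, 1:]) = G + fps_const c" by (simp add: G_def fps_of_poly_diff)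
    then show ?thesis
      unfolding peval_fps_const_shift[OF U] by (simp add: fps_compose_add_distrib add.commute)
  qed
  have unique: "U = fps_inv G" if U: "U $ 0 = 0" "G oo U = fps_X" for U
  proof -
    have "fps_X oo U = (fps_inv G oo G) oo U" by (simp only: fps_inv[OF G0 G1])
    also have "\<dots> = fps_inv G oo fps_X" by (simp only: fps_compose_assoc[OF U(1) G0, symmetric] U(2))
    finally show ?thesis using U(1) by simp
  qed
  have inv0: "fps_inv G $ 0 = 0" by (simp add: fps_inv_def)
  show ?thesis
  proof (rule ex1I[of _ "fps_const r + fps_inv G"])
    show "(fps_const r + fps_inv G) $ 0 = r \<and>
      peval fps_const F (fps_const r + fps_inv G) = fps_const c + fps_X"
      using inv0 solves[OF inv0] fps_inv_right[OF G0 G1] by simp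
    fix Y assume Y: "Y $ 0 = r \<and> peval fps_const F Y = fps_const c + fps_X"
    then have U: "(Y - fps_const r) $ 0 = 0" by simp
    then have "Y - fps_const r = fps_inv G" using unique[OF U] solves[OF U] Y by simp
    then show "Y = fps_const r + fps_inv G" by (simp add: algebra_simps)
  qed
qed

lemma double_zero_not_liftable:
  fixes F :: "'a::field poly"
  assumes F: "[:- w, 1:] ^ 2 dvd F - [:c:]" and Y: "peval fps_const F Y = fps_const c + fps_X"
  shows "Y $ 0 \<noteq> w"
proof
  assume Y0: "Y $ 0 = w"
  obtain h where h: "F - [:c:] = [:- w, 1:] ^ 2 * h" using F by (auto simp: dvd_def)
  define Z where "Z = fps_const (- w) + Y"
  have "peval fps_const (F - [:c:]) Y = peval fps_const ([:- w, 1:] ^ 2 * h) Y" by (simp only: h)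
  then have "fps_X = Z * (Z * peval fps_const h Y)"
    using Y by (simp add: Z_def fps_const.map_poly_hom_diff fps_const.map_poly_hom_mult
        fps_const.map_poly_hom_const fps_const.map_poly_hom_linear power2_eq_square mult.assoc
        del: mult_pCons_left mult_pCons_right)
  then have "fps_X $ 1 = (Z * (Z * peval fps_const h Y)) $ 1" by (rule arg_cong)
  moreover have "Z $ 0 = 0" using Y0 by (simp add: Z_def)
  ultimately show False by (simp add: fps_mult_nth_1)
qed

lemma fls_integral_if_peval_integral:
  fixes F :: "'a::field poly"
  assumes "fls_subdegree (peval fls_const F Y) \<ge> 0" "degree F \<ge> 1"
  shows "fls_subdegree Y \<ge> 0"
proof (rule ccontr)
  assume neg: "\<not> ?thesis"
  define n where "n = degree F"
  define s where "s = int n * fls_subdegree Y"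
  have sub: "fls_subdegree (Y ^ i) = int i * fls_subdegree Y" for i by (simp add: fls_subdegree_pow)
  have low: "fls_nth (fls_const (coeff F i) * Y ^ i) s = 0" if "i < n" for i
  proof -
    have "s < fls_subdegree (Y ^ i)" using that neg by (simp add: sub s_def)
    then show ?thesis by (simp add: fls_eq0_below_subdegree)
  qed
  have "peval fls_const F Y = (\<Sum>i\<le>n. fls_const (coeff F i) * Y ^ i)"
    by (simp add: poly_altdef n_def fls_const.degree_map_poly_hom coeff_map_poly)
  then have "fls_nth (peval fls_const F Y) s = fls_nth (fls_const (coeff F n) * Y ^ n) s"
    using low by (auto simp: fls_nth_sum lessThan_Suc_atMost[symmetric] intro!: sum.neutral)
  also have "\<dots> \<noteq> 0"
  proof -
    have "coeff F n \<noteq> 0" unfolding n_def using assms(2) by auto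
    moreover have "Y ^ n \<noteq> 0" using neg by auto
    then have "fls_nth (Y ^ n) s \<noteq> 0"
      using nth_fls_subdegree_nonzero[of "Y ^ n"] by (simp add: sub s_def)
    ultimately show ?thesis by simp
  qed
  finally have "fls_subdegree (peval fls_const F Y) \<le> s" by (rule fls_subdegree_leI)
  moreover have "s < 0" using neg assms(2) by (simp add: s_def n_def mult_pos_neg)
  ultimately show False using assms(1) by linarith
qed

lemma fls_zeros_eq_fps_zeros:
  fixes F :: "'a::field poly"
  assumes "degree F \<ge> 1"
  shows "{Y. peval fls_const F Y = fls_const c + fls_X}
    = fps_to_fls ` {Y. peval fps_const F Y = fps_const c + fps_X}"
proof -
  have const: "fls_const c + fls_X = fps_to_fls (fps_const c + fps_X)" by simp
  have "fls_subdegree (fls_const c + fls_X) \<ge> 0" unfolding const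
    by (rule fls_subdegree_fls_to_fps_gt0)
  then have integral: "fps_to_fls (fls_regpart Y) = Y"
    if "peval fls_const F Y = fls_const c + fls_X" for Y
    using fls_integral_if_peval_integral[of F Y] that assms by simp
  have transfer: "peval fls_const F (fps_to_fls Y) = fls_const c + fls_X \<longleftrightarrow>
      peval fps_const F Y = fps_const c + fps_X" for Y
    unfolding const peval_fls_const_fps_to_fls by (rule fps_to_fls_eq_iff)
  show ?thesis
  proof (intro equalityI subsetI)
    fix Y assume "Y \<in> {Y. peval fls_const F Y = fls_const c + fls_X}"
    then show "Y \<in> fps_to_fls ` {Y. peval fps_const F Y = fps_const c + fps_X}"
      using integral[of Y] transfer[of "fls_regpart Y"]
      by (intro image_eqI[of _ _ "fls_regpart Y"]) auto
  qed (use transfer in blast)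
qed

lemma card_fls_zeros:
  fixes F :: "'a::field poly"
  assumes F: "degree F \<ge> 1" "[:- w, 1:] ^ 2 dvd F - [:c:]"
    and simple: "\<And>x. poly F x = c \<Longrightarrow> x \<noteq> w \<Longrightarrow> poly (pderiv F) x \<noteq> 0"
  shows "card {Y. peval fls_const F Y = fls_const c + fls_X} = card (zeros (F - [:c:]) - {w})"
proof -
  define S where "S = {Y. peval fps_const F Y = fps_const c + fps_X}"
  have reduction: "poly F (Y $ 0) = c \<and> Y $ 0 \<noteq> w" if "Y \<in> S" for Y
    using that peval_fps_const_nth_0[of F Y] double_zero_not_liftable[OF F(2)] by (simp add: S_def)
  have lift: "\<exists>!Y. Y $ 0 = r \<and> Y \<in> S" if "poly F r = c" "r \<noteq> w" for r
    using ex1_fps_zero_lift[OF that(1) simple[OF that]] by (simp add: S_def)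
  have "bij_betw (\<lambda>Y. Y $ 0) S (zeros (F - [:c:]) - {w})"
  proof (rule bij_betwI')
    show "(Y $ 0 = Y' $ 0) = (Y = Y')" if "Y \<in> S" "Y' \<in> S" for Y Y'
      using that lift reduction by metis
    show "\<exists>Y\<in>S. r = Y $ 0" if "r \<in> zeros (F - [:c:]) - {w}" for r
      using that lift[of r] by auto
  qed (use reduction in auto)
  then have "card S = card (zeros (F - [:c:]) - {w})" by (rule bij_betw_same_card)
  moreover have "card (fps_to_fls ` S) = card S" by (simp add: card_image inj_on_def)
  ultimately show ?thesis by (simp add: fls_zeros_eq_fps_zeros[OF F(1)] S_def)
qed

section \<open>Gauss's lemma for valuations\<close>

locale valuation =
  fixes v :: "'a::idom \<Rightarrow> int"
  assumes v_mult: "x \<noteq> 0 \<Longrightarrow> y \<noteq> 0 \<Longrightarrow> v (x * y) = v x + v y"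
    and v_add: "x \<noteq> 0 \<Longrightarrow> y \<noteq> 0 \<Longrightarrow> x + y \<noteq> 0 \<Longrightarrow> min (v x) (v y) \<le> v (x + y)"
begin

definition above :: "int \<Rightarrow> 'a set" where
  "above m = {x. x \<noteq> 0 \<longrightarrow> m < v x}"

definition gauss_val :: "'a poly \<Rightarrow> int" where
  "gauss_val P = Min ((\<lambda>i. v (coeff P i)) ` {i. coeff P i \<noteq> 0})"

lemma v_uminus: "v (- x) = v x"
proof (cases "x = 0")
  case False
  have "v 1 = 0" using v_mult[of 1 1] by simp
  then have "v (- 1) = 0" using v_mult[of "- 1" "- 1"] by simp
  then show ?thesis using v_mult[of "- 1" x] False by simp
qed simp

lemma above_0: "0 \<in> above m"
  by (simp add: above_def)

lemma above_uminus: "x \<in> above m \<Longrightarrow> - x \<in> above m"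
  by (simp add: above_def v_uminus)

lemma above_add: "x \<in> above m \<Longrightarrow> y \<in> above m \<Longrightarrow> x + y \<in> above m"
  using v_add[of x y] by (cases "x = 0"; cases "y = 0") (auto simp: above_def)

lemma above_sum: "(\<And>i. i \<in> A \<Longrightarrow> g i \<in> above m) \<Longrightarrow> sum g A \<in> above m"
  by (induction A rule: infinite_finite_induct) (auto simp: above_0 above_add)

lemma above_mult: "x \<in> above m \<Longrightarrow> (y \<noteq> 0 \<Longrightarrow> n \<le> v y) \<Longrightarrow> x * y \<in> above (m + n)"
  by (cases "y = 0") (auto simp: above_def v_mult)

lemma finite_support: "finite {i. coeff P i \<noteq> 0}"
  by (rule finite_subset[of _ "{..degree P}"]) (auto intro: le_degree)

lemma gauss_val_le: "coeff P i \<noteq> 0 \<Longrightarrow> gauss_val P \<le> v (coeff P i)"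
  unfolding gauss_val_def using finite_support by (intro Min_le) auto

lemma gauss_val_attained_last:
  assumes "P \<noteq> 0"
  obtains i where "coeff P i \<noteq> 0" "v (coeff P i) = gauss_val P"
    "\<And>j. i < j \<Longrightarrow> coeff P j \<in> above (gauss_val P)"
proof -
  define I where "I = {i. coeff P i \<noteq> 0 \<and> v (coeff P i) = gauss_val P}"
  have "degree P \<in> {i. coeff P i \<noteq> 0}" using assms by simp
  then have "gauss_val P \<in> (\<lambda>i. v (coeff P i)) ` {i. coeff P i \<noteq> 0}"
    unfolding gauss_val_def by (intro Min_in finite_imageI finite_support) blast
  then have I: "I \<noteq> {}" "finite I"
    unfolding I_def by (auto intro: finite_subset[OF _ finite_support[of P]])
  define i where "i = Max I"
  have "i \<in> I" unfolding i_def using I by (intro Max_in)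
  moreover have "coeff P j \<in> above (gauss_val P)" if "i < j" for j
  proof -
    have "j \<notin> I" using that I Max_ge[of I j] by (auto simp: i_def)
    then show ?thesis using gauss_val_le[of P j] by (auto simp: I_def above_def)
  qed
  ultimately show thesis using that by (auto simp: I_def)
qed

lemma gauss_val_smult:
  assumes "a \<noteq> 0" "P \<noteq> 0"
  shows "gauss_val (smult a P) = v a + gauss_val P"
proof (rule antisym)
  have "smult a P \<noteq> 0" using assms by simp
  then obtain i where i: "coeff (smult a P) i \<noteq> 0" "v (coeff (smult a P) i) = gauss_val (smult a P)"
    by (rule gauss_val_attained_last)
  then show "v a + gauss_val P \<le> gauss_val (smult a P)"
    using gauss_val_le[of P i] by (auto simp: v_mult)
  obtain j where j: "coeff P j \<noteq> 0" "v (coeff P j) = gauss_val P"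
    using gauss_val_attained_last[OF assms(2)] by blast
  then show "gauss_val (smult a P) \<le> v a + gauss_val P"
    using gauss_val_le[of "smult a P" j] assms(1) by (simp add: v_mult)
qed

text \<open>At the sum of the last indices where the minima are attained, exactly one term of the
  convolution has minimal valuation.\<close>

lemma gauss_val_mult_le:
  assumes "P \<noteq> 0" "Q \<noteq> 0"
  shows "gauss_val (P * Q) \<le> gauss_val P + gauss_val Q"
proof -
  define m where "m = gauss_val P + gauss_val Q"
  obtain i where i: "coeff P i \<noteq> 0" "v (coeff P i) = gauss_val P"
    "\<And>l. i < l \<Longrightarrow> coeff P l \<in> above (gauss_val P)"
    using gauss_val_attained_last[OF assms(1)] by blast
  obtain j where j: "coeff Q j \<noteq> 0" "v (coeff Q j) = gauss_val Q"
    "\<And>l. j < l \<Longrightarrow> coeff Q l \<in> above (gauss_val Q)"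
    using gauss_val_attained_last[OF assms(2)] by blast
  define rest where "rest = (\<Sum>l\<in>{..i + j} - {i}. coeff P l * coeff Q (i + j - l))"
  have "rest \<in> above m" unfolding rest_def
  proof (rule above_sum)
    fix l assume l: "l \<in> {..i + j} - {i}"
    show "coeff P l * coeff Q (i + j - l) \<in> above m"
    proof (cases "l > i")
      case True
      then show ?thesis unfolding m_def using i(3) gauss_val_le by (intro above_mult)
    next
      case False
      then have "i + j - l > j" using l by simp
      then have "coeff Q (i + j - l) * coeff P l \<in> above (gauss_val Q + gauss_val P)"
        using j(3) gauss_val_le by (intro above_mult)
      then show ?thesis by (simp add: m_def ac_simps)
    qed
  qed
  moreover have "coeff P i * coeff Q j \<notin> above m" using i j by (simp add: above_def v_mult m_def)
  moreover have "coeff (P * Q) (i + j) = coeff P i * coeff Q j + rest"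
    unfolding coeff_mult rest_def by (subst sum.remove[of _ i]) auto
  ultimately have "coeff (P * Q) (i + j) \<notin> above m"
    using above_add[OF _ above_uminus, of "coeff P i * coeff Q j + rest" m rest] by auto
  then show ?thesis using gauss_val_le[of "P * Q" "i + j"] by (auto simp: above_def m_def)
qed

end

interpretation degree_val: valuation "\<lambda>p :: 'a::idom poly. - int (degree p)"
proof
  fix p q :: "'a poly"
  show "- int (degree (p * q)) = - int (degree p) + - int (degree q)" if "p \<noteq> 0" "q \<noteq> 0"
    using that by (simp add: degree_mult_eq)
  show "min (- int (degree p)) (- int (degree q)) \<le> - int (degree (p + q))"
    using degree_add_le_max[of p q] by linarith
qed

interpretation order_val: valuation "\<lambda>p :: 'a::idom poly. int (order a p)" for a
proof
  fix p q :: "'a poly"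
  show "int (order a (p * q)) = int (order a p) + int (order a q)" if "p \<noteq> 0" "q \<noteq> 0"
    using that by (simp add: order_mult)
  assume nz: "p \<noteq> 0" "q \<noteq> 0" "p + q \<noteq> 0"
  let ?n = "min (order a p) (order a q)"
  have "[:- a, 1:] ^ ?n dvd p" "[:- a, 1:] ^ ?n dvd q" by (simp_all add: order_divides)
  then have "[:- a, 1:] ^ ?n dvd p + q" by (rule dvd_add)
  then show "min (int (order a p)) (int (order a q)) \<le> int (order a (p + q))"
    using nz(3) by (simp add: order_divides)
qed

lemma splits_dvd_if_order_le:
  assumes "splits c" "\<And>a. order a c \<le> order a q" "q \<noteq> 0"
  shows "c dvd q"
  using assms
proof (induction c arbitrary: q rule: poly_root_order_induct)
  case (no_roots c)
  then have "degree c = 0" using splits_zero_exists by auto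
  then have "is_unit c" using no_roots by (auto simp: is_unit_iff_degree splits_def)
  then show ?case by (rule unit_imp_dvd)
next
  case (root c x n)
  have nz: "[:- x, 1:] ^ n \<noteq> 0" "c \<noteq> 0" using root.hyps(2) by (auto simp del: mult_pCons_left)
  have order: "order a ([:- x, 1:] ^ n * c) = (if a = x then n else order a c)" for a
    using nz root.hyps(2) by (simp add: order_mult order_power_linear order_0I del: mult_pCons_left)
  have "n \<le> order x q" using root.prems(2)[of x] by (simp add: order)
  then have "[:- x, 1:] ^ n dvd q" by (simp add: order_divides)
  then obtain q' where q': "q = [:- x, 1:] ^ n * q'" by (auto simp: dvd_def)
  have "c dvd q'"
  proof (rule root.IH)
    show "splits c" using splits_dvd[OF root.prems(1)] by simp
    show "q' \<noteq> 0" using root.prems(3) q' by auto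
    show "order a c \<le> order a q'" for a
    proof (cases "a = x")
      case True
      then show ?thesis using root.hyps(2) by (simp add: order_0I)
    next
      case False
      then have "order a q = order a q'"
        using \<open>q' \<noteq> 0\<close> nz(1) by (simp add: q' order_mult order_power_linear del: mult_pCons_left)
      then show ?thesis using root.prems(2)[of a] order[of a] False by simp
    qed
  qed
  then show ?case unfolding q' by (rule mult_dvd_mono[OF dvd_refl])
qed (simp add: splits_def)

section \<open>Lueroth's theorem for polynomials\<close>

lemma monic_dvd_if_map_poly_dvd:
  fixes h :: "'a::idom \<Rightarrow> 'b::idom"
  assumes "inj_comm_ring_hom h" and c: "lead_coeff c = 1" and dvd: "map_poly h c dvd map_poly h P"
  shows "c dvd P"
proof -
  interpret h: inj_comm_ring_hom h by (rule assms(1))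
  have c0: "c \<noteq> 0" using c by auto
  obtain q r where qr: "P = c * q + r" "r = 0 \<or> degree r < degree c"
    using pseudo_divmod[OF c0, of P "fst (pseudo_divmod P c)" "snd (pseudo_divmod P c)"] c by auto
  have "map_poly h c dvd map_poly h r"
    using dvd by (simp add: qr(1) h.map_poly_hom_add h.map_poly_hom_mult dvd_add_right_iff)
  then have "r \<noteq> 0 \<Longrightarrow> degree c \<le> degree r"
    using dvd_imp_degree_le[of "map_poly h c" "map_poly h r"]
    by (simp add: h.degree_map_poly_hom h.map_poly_hom_eq_0_iff)
  then have "r = 0" using qr(2) by fastforce
  then show ?thesis using qr(1) by simp
qed

lemma monic_dvd_smult_cancel:
  fixes c P :: "'a::idom poly"
  assumes "lead_coeff c = 1" "u \<noteq> 0" "c dvd smult u P"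
  shows "c dvd P"
proof (rule monic_dvd_if_map_poly_dvd[OF _ assms(1)])
  interpret to_fract: comm_ring_hom "to_fract :: 'a \<Rightarrow> 'a fract" by unfold_locales simp_all
  show "inj_comm_ring_hom (to_fract :: 'a \<Rightarrow> 'a fract)" by unfold_locales simp_all
  obtain Q where "smult u P = c * Q" using assms(3) by (auto simp: dvd_def)
  then have "smult (to_fract u) (fract_poly P) = fract_poly c * fract_poly Q"
    by (metis to_fract.map_poly_hom_mult to_fract.map_poly_hom_smult)
  then have "fract_poly c dvd smult (to_fract u) (fract_poly P)" by simp
  then show "fract_poly c dvd fract_poly P" using assms(2) by (simp add: dvd_smult_iff)
qed

interpretation const_poly: inj_comm_ring_hom "\<lambda>a :: 'a::comm_ring_1. [:a:]"
proof -
  interpret const_poly: comm_ring_hom "\<lambda>a :: 'a. [:a:]" by unfold_locales (simp_all add: one_pCons)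
  show "inj_comm_ring_hom (\<lambda>a :: 'a. [:a:])" by unfold_locales simp
qed

text \<open>As a simp rule, \<open>[:1:] = 1\<close> would destroy linear polynomials \<open>[:- b, 1:]\<close>.\<close>

declare const_poly.hom_1 [simp del]

text \<open>\<open>p(X) - p(Y)\<close> as a polynomial in \<open>X\<close> with coefficients in \<open>k[Y]\<close>.\<close>

definition difference_poly :: "'a::comm_ring_1 poly \<Rightarrow> 'a poly poly" where
  "difference_poly p = map_poly (\<lambda>a. [:a:]) p - [:p:]"

lemma coeff_difference_poly:
  "coeff (difference_poly p) i = (if i = 0 then [:coeff p 0:] - p else [:coeff p i:])"
  by (simp add: difference_poly_def const_poly.coeff_map_poly_hom coeff_pCons split: nat.split)

lemma degree_difference_poly: "degree (difference_poly p) = degree p"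
  by (simp add: difference_poly_def const_poly.degree_map_poly_hom)

lemma difference_poly_smult: "difference_poly (smult a p) = smult [:a:] (difference_poly p)"
  by (rule poly_eqI) (simp add: coeff_difference_poly smult_diff_right)

lemma difference_poly_minus_const: "difference_poly (p - [:c:]) = difference_poly p"
  by (rule poly_eqI) (simp add: coeff_difference_poly coeff_pCons split: nat.split)

lemma difference_poly_mult:
  "difference_poly (p * q)
    = difference_poly p * map_poly (\<lambda>a. [:a:]) q + smult p (difference_poly q)"
  by (simp add: difference_poly_def const_poly.map_poly_hom_mult left_diff_distrib smult_diff_right)

lemma poly_map_poly_const:
  fixes p :: "'a::comm_ring_1 poly"
  shows "poly (map_poly (\<lambda>a. [:a:]) p) [:a:] = [:poly p a:]"
  using const_poly.poly_map_poly_hom[of p a] .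

lemma difference_poly_dvd_quotient:
  fixes f h :: "'a::field poly"
  assumes h: "lead_coeff h = 1" "degree h \<ge> 1" and f: "f - [:a:] = (h - [:b:]) * g"
    and dvd: "difference_poly h dvd difference_poly f"
  shows "difference_poly h dvd difference_poly g"
proof (rule monic_dvd_smult_cancel)
  show "lead_coeff (difference_poly h) = 1"
    using h by (simp add: degree_difference_poly coeff_difference_poly flip: one_pCons)
  have "degree (h - [:b:]) \<noteq> 0" using h(2) by simp
  then show "h - [:b:] \<noteq> 0" by (metis degree_0)
  have "difference_poly f = difference_poly ((h - [:b:]) * g)"
    by (simp only: difference_poly_minus_const flip: f)
  also have "\<dots> = difference_poly h * map_poly (\<lambda>a. [:a:]) g + smult (h - [:b:]) (difference_poly g)"
    by (simp add: difference_poly_mult difference_poly_minus_const)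
  finally show "difference_poly h dvd smult (h - [:b:]) (difference_poly g)"
    using dvd by (metis dvd_add_right_iff dvd_triv_left)
qed

text \<open>Setting \<open>Y = 0\<close> shows that \<open>h(X) - h(0)\<close> divides \<open>f(X) - f(0)\<close>; the quotient inherits the
  hypothesis.\<close>

lemma decomposable_if_difference_poly_dvd:
  fixes f h :: "'a::field poly"
  assumes h: "lead_coeff h = 1" "degree h \<ge> 1" and "difference_poly h dvd difference_poly f"
  shows "\<exists>g. f = pcompose g h"
  using assms(3)
proof (induction "degree f" arbitrary: f rule: less_induct)
  case less
  interpret eval_0: comm_ring_hom "\<lambda>p :: 'a poly. coeff p 0"
    by unfold_locales (simp_all add: coeff_mult_0)
  have eval: "map_poly (\<lambda>p. coeff p 0) (difference_poly p) = p - [:coeff p 0:]" for p :: "'a poly"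
    by (rule poly_eqI)
      (simp add: eval_0.coeff_map_poly_hom coeff_difference_poly coeff_pCons split: nat.split)
  define a b u where "a = coeff f 0" and "b = coeff h 0" and "u = h - [:b:]"
  have "u dvd f - [:a:]"
    using less.prems
    by (auto simp: dvd_def a_def b_def u_def eval_0.map_poly_hom_mult simp flip: eval)
  then obtain f1 where f1: "f - [:a:] = u * f1" by (auto simp: dvd_def)
  show ?case
  proof (cases "f1 = 0")
    case True
    then have "f = pcompose [:a:] h" using f1 by simp
    then show ?thesis by blast
  next
    case False
    have deg_u: "degree u = degree h" by (simp add: u_def)
    have "degree (f - [:a:]) = degree u + degree f1"
      unfolding f1 using False deg_u h(2) by (intro degree_mult_eq) auto
    then have "degree f1 < degree f" using deg_u h(2) by simp
    moreover have "difference_poly h dvd difference_poly f1"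
      using difference_poly_dvd_quotient[OF h f1[unfolded u_def] less.prems] .
    ultimately obtain g where g: "f1 = pcompose g h" using less.hyps by blast
    have "f = [:a:] + u * f1" by (simp flip: f1)
    also have "\<dots> = pcompose ([:a:] + [:- b, 1:] * g) h"
      unfolding g pcompose_add pcompose_mult by (simp add: u_def pcompose_pCons pcompose_1)
    finally show ?thesis by blast
  qed
qed

lemma difference_poly_coprime_const:
  fixes h q :: "'a::field poly"
  assumes ac: "alg_closed_field TYPE('a)" and h: "degree h \<ge> 1"
    and dvd: "map_poly (\<lambda>a. [:a:]) q dvd difference_poly h"
  shows "degree q = 0"
proof (rule ccontr)
  assume "degree q \<noteq> 0"
  then obtain a where "poly q a = 0" using ac unfolding alg_closed_field_def
    by (metis One_nat_def Suc_leI neq0_conv)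
  then have "poly (difference_poly h) [:a:] = 0" using dvd
    by (auto simp: dvd_def poly_map_poly_const)
  then have "[:poly h a:] = h" by (simp add: difference_poly_def poly_map_poly_const)
  then show False using h by (metis degree_pCons_0 not_one_le_zero)
qed

lemma map_poly_const_if_coeffs_const:
  assumes "\<And>i. degree (coeff P i) = 0"
  shows "P = map_poly (\<lambda>a. [:a:]) (map_poly (\<lambda>p. coeff p 0) P)"
proof (rule poly_eqI)
  fix i
  have "coeff P i = [:coeff (coeff P i) 0:]" using assms[of i]
    by (metis degree_eq_zeroE coeff_pCons_0)
  then show "coeff P i = coeff (map_poly (\<lambda>a. [:a:]) (map_poly (\<lambda>p. coeff p 0) P)) i"
    by (simp add: coeff_map_poly)
qed

text \<open>Comparing degrees in \<open>Y\<close>, the cofactor does not involve \<open>Y\<close>.\<close>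

lemma difference_poly_associated_factor:
  fixes c :: "'a::field poly poly"
  assumes ac: "alg_closed_field TYPE('a)" and i: "degree (coeff c i) \<ge> 1"
    and dvd: "c dvd difference_poly (coeff c i)"
  obtains l where "l \<noteq> 0" "difference_poly (coeff c i) = smult [:l:] c"
proof -
  define h where "h = coeff c i"
  obtain q where q: "difference_poly h = c * q" using dvd by (auto simp: dvd_def h_def)
  have "difference_poly h \<noteq> 0"
    using i degree_difference_poly[of h] unfolding h_def by (metis degree_0 not_one_le_zero)
  then have nz: "c * q \<noteq> 0" "c \<noteq> 0" "q \<noteq> 0" using q by auto
  have "degree (coeff (c * q) j) \<le> degree h" for j
    unfolding q[symmetric] by (auto simp: coeff_difference_poly intro: degree_diff_le)
  then have "- int (degree h) \<le> degree_val.gauss_val (c * q)"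
    using degree_val.gauss_val_attained_last[OF nz(1)] by (metis neg_le_iff_le of_nat_le_iff)
  also have "\<dots> \<le> degree_val.gauss_val c + degree_val.gauss_val q"
    using nz(2,3) by (rule degree_val.gauss_val_mult_le)
  also have "degree_val.gauss_val c \<le> - int (degree h)"
    unfolding h_def using i by (intro degree_val.gauss_val_le) auto
  finally have "degree (coeff q l) = 0" for l
    using degree_val.gauss_val_le[of q l] by (cases "coeff q l = 0") auto
  then have q': "q = map_poly (\<lambda>a. [:a:]) (map_poly (\<lambda>p. coeff p 0) q)" (is "q = map_poly _ ?q'")
    by (rule map_poly_const_if_coeffs_const)
  then have "map_poly (\<lambda>a. [:a:]) ?q' dvd difference_poly h" using q by simp
  then have "degree ?q' = 0" using difference_poly_coprime_const[OF ac] i by (simp add: h_def)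
  then obtain l where "?q' = [:l:]" by (rule degree_eq_zeroE)
  then have "q = [:[:l:]:]" using q' by (simp add: const_poly.map_poly_hom_const)
  then show thesis using that[of l] q nz(3) by (simp add: h_def)
qed

text \<open>At every \<open>a\<close> the Gauss valuation of the product is at least the sum of the orders of the
  leading coefficients, so each leading coefficient has minimal order among the coefficients.\<close>

lemma lead_coeff_divides_factor:
  fixes C D P :: "'a::field poly poly"
  assumes ac: "alg_closed_field TYPE('a)" and nz: "C \<noteq> 0" "D \<noteq> 0"
    and prod: "C * D = smult (lead_coeff C * lead_coeff D) P"
  obtains C' where "C = smult (lead_coeff C) C'"
proof -
  let ?c = "lead_coeff C" and ?d = "lead_coeff D"
  have lead_nz: "?c \<noteq> 0" "?d \<noteq> 0" using nz by simp_all
  have P: "P \<noteq> 0" using nz prod by auto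
  have order: "order a ?c \<le> order a (coeff C i)" if i: "coeff C i \<noteq> 0" for a i
  proof -
    let ?v = "order_val.gauss_val a"
    obtain j where "coeff P j \<noteq> 0" "int (order a (coeff P j)) = ?v P"
      using order_val.gauss_val_attained_last[OF P] by blast
    then have "?v (smult (?c * ?d) P) \<ge> int (order a ?c) + int (order a ?d)"
      using order_val.gauss_val_smult[of "?c * ?d" P a] lead_nz P by (simp add: order_mult)
    moreover have "?v (C * D) \<le> ?v C + ?v D" using nz by (rule order_val.gauss_val_mult_le)
    moreover have "?v D \<le> int (order a ?d)" using lead_nz by (intro order_val.gauss_val_le)
    moreover have "?v C \<le> int (order a (coeff C i))" using i by (intro order_val.gauss_val_le)
    ultimately show ?thesis unfolding prod by linarith
  qed
  have "?c dvd coeff C i" for i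
    using splits_dvd_if_order_le[OF alg_closed_splits[OF ac lead_nz(1)] order]
    by (cases "coeff C i = 0") auto
  then have "C = smult ?c (map_poly (\<lambda>p. p div ?c) C)"
    by (intro poly_eqI) (simp add: coeff_map_poly)
  then show thesis by (rule that)
qed

context transcendental_element
begin

lemma subfield_simple_extension: "subfield simple_extension"
  by (rule fract_eval.subfield_range)

lemma value_at_in_simple_extension: "value_at p \<in> simple_extension"
  by (metis fract_eval_poly rangeI)

lemma map_poly_value_at_difference_poly:
  "map_poly value_at (difference_poly p) = map_poly \<kappa> p - [:value_at p:]"
  by (simp add: difference_poly_def value_at.map_poly_hom_diff value_at.map_poly_hom_const
      map_poly_map_poly o_def map_poly_hom_const)

lemma common_denominator:
  "C \<in> polys_over simple_extension \<Longrightarrow> \<exists>c C1. c \<noteq> 0 \<and> map_poly value_at C1 = smult (value_at c) C"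
proof (induction C)
  case 0
  show ?case by (intro exI[of _ 1] exI[of _ 0]) simp
next
  case (pCons a C)
  interpret E: subfield simple_extension by (rule subfield_simple_extension)
  obtain z where z: "a = fract_eval \<kappa> \<beta> z" using pCons.prems by (auto simp: E.polys_over_pCons_iff)
  obtain p q where pq: "z = Fract p q" "q \<noteq> 0" by (cases z)
  have a: "value_at q * a = value_at p"
    using pq(2) by (simp add: z pq fract_eval_Fract value_at.hom_eq_0_iff)
  obtain c C1 where c: "c \<noteq> 0" "map_poly value_at C1 = smult (value_at c) C"
    using pCons.prems pCons.IH by (auto simp: E.polys_over_pCons_iff)
  have "map_poly value_at (pCons (p * c) (smult q C1)) = smult (value_at (q * c)) (pCons a C)"
    by (simp add: value_at.map_poly_hom_pCons value_at.map_poly_hom_smult c(2) map_poly_hom_mult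
        mult_ac flip: a)
  then show ?case using c(1) pq(2) by (metis mult_eq_0_iff)
qed

lemma monic_lift_denominator:
  assumes C: "C \<in> polys_over simple_extension" "lead_coeff C = 1"
  obtains C1 where "C1 \<noteq> 0" "map_poly value_at C1 = smult (value_at (lead_coeff C1)) C"
proof -
  obtain c C1 where c: "c \<noteq> 0" "map_poly value_at C1 = smult (value_at c) C"
    using common_denominator[OF C(1)] by blast
  have "degree C1 = degree C" using c value_at.degree_map_poly_hom[of C1]
    by (simp add: value_at.hom_eq_0_iff)
  then have "value_at (lead_coeff C1) = value_at c"
    using C(2) c(2) by (metis value_at.coeff_map_poly_hom coeff_smult mult.right_neutral)
  then have "lead_coeff C1 = c" by (simp add: value_at.hom_eq_iff)
  then show thesis using that c by force
qed

lemma monic_factor_integral: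
  assumes alg_closed: "alg_closed_field TYPE('k)"
    and C: "C \<in> polys_over simple_extension" "lead_coeff C = 1"
    and D: "D \<in> polys_over simple_extension" "lead_coeff D = 1"
    and CD: "C * D = map_poly value_at P"
  obtains c where "C = map_poly value_at c"
proof -
  obtain C1 where C1: "C1 \<noteq> 0" "map_poly value_at C1 = smult (value_at (lead_coeff C1)) C"
    using monic_lift_denominator[OF C] .
  obtain D1 where D1: "D1 \<noteq> 0" "map_poly value_at D1 = smult (value_at (lead_coeff D1)) D"
    using monic_lift_denominator[OF D] .
  have "map_poly value_at (C1 * D1) = map_poly value_at (smult (lead_coeff C1 * lead_coeff D1) P)"
    by (simp add: value_at.map_poly_hom_mult value_at.map_poly_hom_smult C1(2) D1(2)
        map_poly_hom_mult mult_ac flip: CD)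
  then have "C1 * D1 = smult (lead_coeff C1 * lead_coeff D1) P"
    by (simp only: value_at.map_poly_hom_eq_iff)
  then obtain C2 where C2: "C1 = smult (lead_coeff C1) C2"
    using lead_coeff_divides_factor[OF alg_closed C1(1) D1(1)] by blast
  define e where "e = value_at (lead_coeff C1)"
  have "smult e C = smult e (map_poly value_at C2)"
    unfolding e_def using C1(2) C2 value_at.map_poly_hom_smult by metis
  then have "smult (inverse e) (smult e C) = smult (inverse e) (smult e (map_poly value_at C2))"
    by (rule arg_cong)
  then have "C = map_poly value_at C2" using C1(1) by (simp add: e_def value_at.hom_eq_0_iff)
  then show thesis using that by blast
qed

lemma nonconstant_coeff_exists:
  assumes "poly (map_poly value_at c) \<beta> = 0" "c \<noteq> 0"
  obtains i where "degree (coeff c i) \<ge> 1"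
proof (rule ccontr)
  assume "\<not> thesis"
  then have "degree (coeff c i) = 0" for i using that[of i] by (cases "degree (coeff c i)") auto
  then have c: "c = map_poly (\<lambda>a. [:a:]) (map_poly (\<lambda>p. coeff p 0) c)" (is "c = map_poly _ ?c'")
    by (rule map_poly_const_if_coeffs_const)
  then have "map_poly value_at c = map_poly value_at (map_poly (\<lambda>a. [:a:]) ?c')" by (rule arg_cong)
  also have "\<dots> = map_poly \<kappa> ?c'" by (simp add: map_poly_map_poly o_def map_poly_hom_const)
  finally have "value_at ?c' = 0" using assms(1) by simp
  then have "?c' = 0" by (simp add: value_at.hom_eq_0_iff)
  then show False using c assms(2) by simp
qed

lemma monic_if_map_poly_value_at_monic:
  assumes "lead_coeff (map_poly value_at c) = 1"
  shows "lead_coeff c = 1"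
proof -
  have "value_at (lead_coeff c) = value_at 1"
    using assms by (simp add: value_at.coeff_map_poly_hom value_at.degree_map_poly_hom)
  then show ?thesis by (simp only: value_at.hom_eq_iff)
qed

theorem lueroth_generator:
  assumes alg_closed: "alg_closed_field TYPE('k)"
    and B: "finite B" "\<beta> \<in> B" and c: "(\<Prod>b\<in>B. [:- b, 1:]) = map_poly value_at c"
    and inv: "\<And>b i. b \<in> B \<Longrightarrow> peval \<kappa> (coeff c i) b = value_at (coeff c i)"
  obtains h where "c = difference_poly h"
proof -
  have lead_c: "lead_coeff c = 1"
    by (rule monic_if_map_poly_value_at_monic) (simp flip: c add: lead_coeff_prod)
  have "poly (map_poly value_at c) \<beta> = 0" using B by (auto simp: poly_prod simp flip: c)
  moreover have "c \<noteq> 0" using lead_c by auto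
  ultimately obtain i where i: "degree (coeff c i) \<ge> 1" by (rule nonconstant_coeff_exists)
  define h where "h = coeff c i"
  have "B \<subseteq> zeros (map_poly value_at (difference_poly h))"
    using inv by (auto simp: map_poly_value_at_difference_poly h_def)
  then have "map_poly value_at c dvd map_poly value_at (difference_poly h)"
    unfolding c[symmetric] by (rule prod_linear_dvd[OF B(1)])
  then have "c dvd difference_poly h"
    by (rule monic_dvd_if_map_poly_dvd[OF value_at.inj_comm_ring_hom_axioms lead_c])
  then obtain l where "l \<noteq> 0" "difference_poly h = smult [:l:] c"
    using difference_poly_associated_factor[OF alg_closed] i unfolding h_def by blast
  then have "c = difference_poly (smult (inverse l) h)"
    by (simp add: difference_poly_smult flip: one_pCons)
  then show thesis by (rule that)
qed

lemma invariant_coeffs: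
  assumes c: "(\<Prod>b\<in>B. [:- b, 1:]) = map_poly value_at c"
    and \<sigma>: "field_hom \<sigma>" "\<And>a. \<sigma> (\<kappa> a) = \<kappa> a" "\<sigma> ` B = B"
  shows "peval \<kappa> (coeff c i) (\<sigma> \<beta>) = value_at (coeff c i)"
proof -
  interpret \<sigma>: field_hom \<sigma> by (rule \<sigma>(1))
  have "map_poly \<sigma> (map_poly value_at c) = map_poly value_at c"
    by (simp only: \<sigma>.map_poly_hom_prod_linear \<sigma>(3) flip: c)
  then have "\<sigma> (value_at (coeff c i)) = value_at (coeff c i)"
    by (metis \<sigma>.coeff_map_poly_hom value_at.coeff_map_poly_hom)
  then show ?thesis by (simp add: \<sigma>.hom_peval \<sigma>(2))
qed

lemma block_polynomial_integral:
  assumes alg_closed: "alg_closed_field TYPE('k)"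
    and f: "degree f \<ge> 1" and B: "finite B" "B \<subseteq> {x. peval \<kappa> f x = value_at f}"
    and C: "(\<Prod>b\<in>B. [:- b, 1:]) \<in> polys_over simple_extension"
  obtains c where "(\<Prod>b\<in>B. [:- b, 1:]) = map_poly value_at c"
proof -
  let ?C = "\<Prod>b\<in>B. [:- b, 1:]"
  interpret E: subfield simple_extension by (rule subfield_simple_extension)
  define H where "H = difference_poly (smult (inverse (lead_coeff f)) f)"
  have "?C dvd map_poly value_at H"
  proof (rule prod_linear_dvd[OF B(1)])
    show "B \<subseteq> zeros (map_poly value_at H)"
      using B(2) by (auto simp: map_poly_value_at_difference_poly H_def map_poly_hom_smult)
  qed
  then obtain D where D: "map_poly value_at H = ?C * D" by (auto simp: dvd_def)
  have "lead_coeff H = 1"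
    using f by (auto simp: degree_difference_poly coeff_difference_poly H_def simp flip: one_pCons)
  then have "lead_coeff (map_poly value_at H) = 1"
    by (simp add: value_at.coeff_map_poly_hom value_at.degree_map_poly_hom)
  then have lead_D: "lead_coeff D = 1" by (simp add: D lead_coeff_mult lead_coeff_prod)
  have "map_poly value_at H \<in> polys_over simple_extension"
    by (simp add: polys_over_def value_at.coeff_map_poly_hom value_at_in_simple_extension)
  moreover have "?C \<noteq> 0" using B(1) by simp
  ultimately have "D \<in> polys_over simple_extension"
    using E.polys_over_div[OF C] by (metis D nonzero_mult_div_cancel_left)
  then show thesis
    using monic_factor_integral[OF alg_closed C _ _ lead_D D[symmetric]] that
    by (auto simp: lead_coeff_prod)
qed

theorem block_card_indecomposable:
  assumes alg_closed: "alg_closed_field TYPE('k)"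
    and f: "indecomposable_poly f" "degree f \<ge> 1"
    and B: "finite B" "\<beta> \<in> B" "B \<subseteq> {x. peval \<kappa> f x = value_at f}"
    and C: "(\<Prod>b\<in>B. [:- b, 1:]) \<in> polys_over simple_extension"
    and conj: "\<And>b. b \<in> B \<Longrightarrow> \<exists>\<sigma>. field_hom \<sigma> \<and> (\<forall>a. \<sigma> (\<kappa> a) = \<kappa> a) \<and> \<sigma> \<beta> = b \<and> \<sigma> ` B = B"
  shows "card B = 1 \<or> card B = degree f"
proof -
  obtain c where c: "(\<Prod>b\<in>B. [:- b, 1:]) = map_poly value_at c"
    using block_polynomial_integral[OF alg_closed f(2) B(1,3) C] .
  have lead_c: "lead_coeff c = 1"
    by (rule monic_if_map_poly_value_at_monic) (simp flip: c add: lead_coeff_prod)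
  have "peval \<kappa> (coeff c i) b = value_at (coeff c i)" if "b \<in> B" for b i
    using invariant_coeffs[OF c] conj[OF that] by blast
  then obtain h where h: "c = difference_poly h" using lueroth_generator[OF alg_closed B(1,2) c]
    by blast
  have "degree h = card B"
    using arg_cong[OF c, of degree] B(1)
    by (simp add: degree_prod_linear value_at.degree_map_poly_hom h degree_difference_poly)
  then have deg_h: "degree h \<ge> 1" using B(1,2) by (metis One_nat_def Suc_leI card_gt_0_iff empty_iff)
  then have lead_h: "lead_coeff h = 1" using lead_c
    by (simp add: h degree_difference_poly coeff_difference_poly one_pCons)
  have "B \<subseteq> zeros (map_poly value_at (difference_poly f))"
    using B(3) by (auto simp: map_poly_value_at_difference_poly)
  then have "map_poly value_at c dvd map_poly value_at (difference_poly f)"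
    unfolding c[symmetric] by (rule prod_linear_dvd[OF B(1)])
  then have "difference_poly h dvd difference_poly f"
    unfolding h[symmetric]
    by (rule monic_dvd_if_map_poly_dvd[OF value_at.inj_comm_ring_hom_axioms lead_c])
  then obtain g where g: "f = pcompose g h"
    using decomposable_if_difference_poly_dvd[OF lead_h deg_h] by blast
  then have "degree g = 1 \<or> degree h = 1" using f(1) unfolding indecomposable_poly_def by blast
  then show ?thesis using g \<open>degree h = card B\<close> by (auto simp: degree_pcompose)
qed

end

section \<open>The levels of the tree of preimages\<close>

lemma degree_gal_poly: "degree (gal_poly f n) = degree f ^ n"
proof -
  interpret const: field_hom "\<lambda>a :: 'a::field. Fract [:a:] 1"
    by unfold_locales (simp_all add: One_fract_def one_pCons mult.commute)
  show ?thesis by (simp add: gal_poly_def const.degree_map_poly_hom degree_poly_iter)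
qed

lemma (in generic_critical_orbits) gal_poly_nonzero: "gal_poly f n \<noteq> 0"
proof
  assume "gal_poly f n = 0"
  then have "degree (gal_poly f n) = 0" by simp
  then show False using d_ge_2 by (simp add: degree_gal_poly degree_f)
qed

locale iterated_splitting_field = generic_critical_orbits f d N
  for f :: "'k::field poly" and d N :: nat +
  fixes \<phi> :: "'k poly fract \<Rightarrow> 'L::field"
  assumes is_splitting: "is_splitting_field \<phi> (gal_poly f N)"

sublocale iterated_splitting_field \<subseteq> splitting_field \<phi> "gal_poly f N"
proof -
  interpret \<phi>: field_hom \<phi> using is_splitting by (simp add: is_splitting_field_def is_field_hom_iff)
  show "splitting_field \<phi> (gal_poly f N)"
    using is_splitting gal_poly_nonzero by unfold_locales
qed

context iterated_splitting_field
begin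

definition \<kappa> :: "'k \<Rightarrow> 'L" where "\<kappa> = (\<lambda>a. \<phi> (Fract [:a:] 1))"

definition T :: 'L where "T = \<phi> (Fract [:0, 1:] 1)"

definition level :: "nat \<Rightarrow> 'L set" where "level n = {x. (peval \<kappa> f ^^ n) x = T}"

definition fiber :: "'L \<Rightarrow> 'L set" where "fiber \<alpha> = {x. peval \<kappa> f x = \<alpha>}"

lemma T_transcendental: "transcendental_element \<kappa> T"
  unfolding \<kappa>_def T_def by (rule field_hom_fract_decomp(1)[OF field_hom_axioms])

sublocale \<kappa>: field_hom \<kappa>
  by (rule transcendental_element.axioms(1)[OF T_transcendental])

sublocale T: transcendental_element \<kappa> T
  by (rule T_transcendental)

lemma \<phi>_eq_fract_eval: "\<phi> = fract_eval \<kappa> T"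
  unfolding \<kappa>_def T_def by (rule field_hom_fract_decomp(2)[OF field_hom_axioms])

lemma T_not_constant: "T \<noteq> \<kappa> a"
  using T.transcendental[of "[:- a, 1:]"]
  by (auto simp: \<kappa>.map_poly_hom_linear)

lemma map_poly_gal_poly: "map_poly \<phi> (gal_poly f n) = map_poly \<kappa> (poly_iter f n) - [:T:]"
  using T.map_poly_fract_eval_gal_poly by (simp flip: \<phi>_eq_fract_eval)

lemma level_iff: "x \<in> level n \<longleftrightarrow> peval \<kappa> (poly_iter f n) x = T"
  by (simp add: level_def \<kappa>.peval_poly_iter)

lemma zeros_gal_poly: "zeros (map_poly \<phi> (gal_poly f n)) = level n"
  by (auto simp: map_poly_gal_poly level_iff)

lemma level_transcendental:
  assumes "x \<in> level n"
  shows "transcendental_element \<kappa> x"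
proof (unfold_locales, rule notI)
  fix p :: "'k poly" assume "p \<noteq> 0" "peval \<kappa> p x = 0"
  then obtain a where "x = \<kappa> a"
    using \<kappa>.zero_in_range_if_splits alg_closed_splits[OF alg_closed] by blast
  then show False using assms T_not_constant[of "poly (poly_iter f n) a"]
    by (simp add: level_iff \<kappa>.poly_map_poly_hom)
qed

lemma level_simple_zeros:
  assumes "x \<in> level n"
  shows "poly (pderiv (map_poly \<phi> (gal_poly f n))) x \<noteq> 0"
proof -
  have "pderiv (map_poly \<phi> (gal_poly f n)) = map_poly \<kappa> (pderiv (poly_iter f n))"
    by (simp add: map_poly_gal_poly pderiv_diff \<kappa>.map_poly_hom_pderiv)
  then show ?thesis
    using transcendental_element.transcendental[OF level_transcendental[OF assms]]
      pderiv_poly_iter_nonzero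
    by simp
qed

lemma finite_level: "finite (level n)"
  using gal_poly_nonzero[of n] poly_roots_finite[of "map_poly \<phi> (gal_poly f n)"]
  by (simp add: map_poly_hom_eq_0_iff zeros_gal_poly)

lemma level_0: "level 0 = {T}"
  by (auto simp: level_def)

lemma level_Suc_iff: "x \<in> level (Suc n) \<longleftrightarrow> peval \<kappa> f x \<in> level n"
  by (simp add: level_def funpow_swap1)

lemma level_Suc: "level (Suc n) = (\<Union>\<alpha>\<in>level n. fiber \<alpha>)"
  by (auto simp: level_Suc_iff fiber_def)

lemma finite_fiber: "finite (fiber \<alpha>)" and card_fiber_le: "card (fiber \<alpha>) \<le> d"
proof -
  have deg: "degree (map_poly \<kappa> f - [:\<alpha>:]) = d" by (simp add: \<kappa>.degree_map_poly_hom degree_f)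
  then have nz: "map_poly \<kappa> f - [:\<alpha>:] \<noteq> 0" using d_ge_2 by (metis degree_0 not_numeral_le_zero)
  have "fiber \<alpha> = zeros (map_poly \<kappa> f - [:\<alpha>:])" by (auto simp: fiber_def)
  then show "finite (fiber \<alpha>)" "card (fiber \<alpha>) \<le> d"
    using poly_roots_finite[OF nz] card_poly_roots_bound[OF nz] deg by simp_all
qed

lemma card_level_Suc: "card (level (Suc n)) = (\<Sum>\<alpha>\<in>level n. card (fiber \<alpha>))"
  unfolding level_Suc using finite_level finite_fiber
  by (intro card_UN_disjoint) (auto simp: fiber_def)

lemma card_level_N: "card (level N) = d ^ N"
proof -
  have "card (zeros (map_poly \<phi> (gal_poly f N))) = degree (map_poly \<phi> (gal_poly f N))"
    using splits_P level_simple_zeros zeros_gal_poly by (intro splits_card_simple_zeros) auto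
  then show ?thesis by (simp add: zeros_gal_poly degree_map_poly_hom degree_gal_poly degree_f)
qed

text \<open>Level \<open>N\<close> has \<open>d^N\<close> elements and every fiber at most \<open>d\<close>, so no fiber below it is smaller.\<close>

lemma card_level:
  assumes "n \<le> N"
  shows "card (level n) = d ^ n"
proof (rule antisym)
  have "card (level (n + j)) \<le> d ^ j * card (level n)" for j
  proof (induction j)
    case (Suc j)
    have "card (level (Suc (n + j))) \<le> card (level (n + j)) * d"
      unfolding card_level_Suc using card_fiber_le by (intro order_trans[OF sum_bounded_above]) auto
    also have "\<dots> \<le> (d ^ j * card (level n)) * d" using Suc by (rule mult_le_mono1)
    finally show ?case by (simp add: mult_ac)
  qed simp
  from this[of "N - n"] have "d ^ (N - n) * d ^ n \<le> d ^ (N - n) * card (level n)"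
    using assms card_level_N by (simp flip: power_add)
  then show "d ^ n \<le> card (level n)" using d_ge_2 by simp
  show "card (level n) \<le> d ^ n"
    using card_poly_roots_bound[of "map_poly \<phi> (gal_poly f n)"] gal_poly_nonzero[of n]
    by (simp add: map_poly_hom_eq_0_iff zeros_gal_poly degree_map_poly_hom degree_gal_poly degree_f)
qed

lemma card_fiber:
  assumes "\<alpha> \<in> level n" "n < N"
  shows "card (fiber \<alpha>) = d"
proof (rule ccontr)
  assume "card (fiber \<alpha>) \<noteq> d"
  then have "card (fiber \<alpha>) < d" using card_fiber_le[of \<alpha>] by simp
  then have "(\<Sum>\<alpha>\<in>level n. card (fiber \<alpha>)) < (\<Sum>\<alpha>\<in>level n. d)"
    using assms(1) finite_level card_fiber_le by (intro sum_strict_mono_ex1) auto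
  then show False using card_level[of n] card_level[of "Suc n"] assms(2) card_level_Suc[of n]
    by simp
qed

lemma level_splits_separably:
  assumes "n \<le> N"
  shows "splits_separably (map_poly \<phi> (gal_poly f n))"
  unfolding splits_separably_def zeros_gal_poly
  using gal_poly_nonzero card_level[OF assms]
  by (simp add: map_poly_hom_eq_0_iff degree_map_poly_hom degree_gal_poly degree_f)

end

sublocale iterated_splitting_field \<subseteq> separable_splitting_field \<phi> "gal_poly f N"
  by unfold_locales (rule level_splits_separably[OF order_refl])

context iterated_splitting_field
begin

lemma Gal_\<kappa>: "\<sigma> \<in> Gal \<Longrightarrow> \<sigma> (\<kappa> a) = \<kappa> a"
  by (simp add: Gal_iff \<kappa>_def)

lemma Gal_peval:
  assumes "\<sigma> \<in> Gal"
  shows "\<sigma> (peval \<kappa> p x) = peval \<kappa> p (\<sigma> x)"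
proof -
  interpret \<sigma>: field_hom \<sigma> using assms by (simp add: Gal_iff)
  show ?thesis by (simp add: \<sigma>.hom_peval Gal_\<kappa>[OF assms])
qed

lemma Gal_level: "\<sigma> \<in> Gal \<Longrightarrow> x \<in> level n \<Longrightarrow> \<sigma> x \<in> level n"
  using Gal_zeros unfolding zeros_gal_poly[symmetric] .

lemma \<phi>_through_level: "\<exists>z'. \<forall>\<beta>\<in>level n. \<phi> z = fract_eval \<kappa> \<beta> z'"
proof -
  obtain p q where z: "z = Fract p q" "q \<noteq> 0" by (cases z)
  let ?F = "poly_iter f n"
  have "degree ?F \<noteq> 0" using d_ge_2 by (simp add: degree_poly_iter degree_f)
  then have q: "pcompose q ?F \<noteq> 0" using z(2) by (simp add: pcompose_eq_0_iff)
  have "\<phi> z = fract_eval \<kappa> \<beta> (Fract (pcompose p ?F) (pcompose q ?F))" if \<beta>: "\<beta> \<in> level n" for \<beta>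
    using \<beta> T.fract_eval_Fract[OF z(2)]
      transcendental_element.fract_eval_Fract[OF level_transcendental[OF \<beta>] q]
    by (simp add: \<kappa>.peval_pcompose level_iff \<phi>_eq_fract_eval[THEN fun_cong] z(1))
  then show ?thesis by blast
qed

lemma range_\<phi>_level: "\<beta> \<in> level n \<Longrightarrow> range \<phi> \<subseteq> range (fract_eval \<kappa> \<beta>)"
  using \<phi>_through_level[of n] by (metis image_subsetI rangeI)

text \<open>All elements of a level are transcendental over the constants, so they generate isomorphic
  extensions of \<open>k\<close>, compatibly with the embedding of \<open>k(t)\<close>.\<close>

lemma Gal_transitive:
  assumes "\<beta> \<in> level n" "\<beta>' \<in> level n"
  obtains \<sigma> where "\<sigma> \<in> Gal" "\<sigma> \<beta> = \<beta>'"
proof -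
  let ?\<psi> = "fract_eval \<kappa> \<beta>" and ?\<psi>' = "fract_eval \<kappa> \<beta>'"
  interpret \<beta>: transcendental_element \<kappa> \<beta> by (rule level_transcendental[OF assms(1)])
  interpret \<beta>': transcendental_element \<kappa> \<beta>' by (rule level_transcendental[OF assms(2)])
  define \<tau> where "\<tau> = (\<lambda>y. ?\<psi>' (inv_into UNIV ?\<psi> y))"
  have \<tau>: "\<tau> (?\<psi> z) = ?\<psi>' z" for z unfolding \<tau>_def by (simp add: inv_f_f \<beta>.fract_eval.inj_on_hom)
  have "\<tau> (\<phi> z) = \<phi> z" for z using \<phi>_through_level[of n z] assms \<tau> by metis
  then obtain \<sigma> where \<sigma>: "\<sigma> \<in> Gal" "\<forall>y\<in>range ?\<psi>. \<sigma> y = \<tau> y"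
    using Gal_extend[OF \<beta>.fract_eval.subfield_hom_inv_into[OF \<beta>'.field_hom_fract_eval]
        range_\<phi>_level[OF assms(1)]]
    unfolding \<tau>_def by blast
  have "\<sigma> \<beta> = \<tau> \<beta>" using \<sigma>(2) \<beta>.fract_eval_X by (metis rangeI)
  also have "\<dots> = \<beta>'" using \<tau>[of "Fract [:0, 1:] 1"] by (simp add: \<beta>.fract_eval_X \<beta>'.fract_eval_X)
  finally show thesis using that \<sigma>(1) by blast
qed

section \<open>Transpositions in the Galois group\<close>

definition swaps :: "nat \<Rightarrow> 'L \<Rightarrow> 'L \<Rightarrow> bool" where
  "swaps n a b \<longleftrightarrow> (\<exists>\<sigma>\<in>Gal. \<forall>x\<in>level n. \<sigma> x = transpose a b x)"

text \<open>Specialise \<open>t\<close> to the critical value \<open>c = f^n(w)\<close>. A subfield of the splitting field that embeds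
  into \<open>k((t - c))\<close> and cannot be enlarged contains all but two roots, because \<open>f^n - c\<close> has one
  double root and otherwise simple roots.\<close>

lemma subfield_omitting_two:
  assumes n: "1 \<le> n" "n \<le> N"
  obtains E where "subfield E" "range \<phi> \<subseteq> E" "card (level n - E) = 2"
proof -
  obtain w where w: "w \<in> critical_points f" by (rule critical_point_exists)
  define F where "F = poly_iter f n"
  define c where "c = poly F w"
  have degF: "degree F = d ^ n" by (simp add: F_def degree_poly_iter degree_f)
  then have "degree F > 0" using d_ge_2 by simp
  then have nz: "F - [:c:] \<noteq> 0" by (metis degree_0 degree_minus_const less_irrefl)
  have order: "order w (F - [:c:]) = 2"
    unfolding F_def c_def by (rule iterate_order_at_critical_point[OF w n])
  have simple: "poly (pderiv F) x \<noteq> 0" if "poly F x = c" "x \<noteq> w" for x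
    using iterate_simple_away_from_critical_point[OF w n(2)] that by (simp add: F_def c_def)
  have "card (zeros (F - [:c:]) - {w}) + 2 = d ^ n"
    using splits_card_zeros_except[OF alg_closed_splits[OF alg_closed nz], of w] simple order degF
    by (simp add: c_def pderiv_diff)
  moreover have "[:- w, 1:] ^ 2 dvd F - [:c:]" using order by (simp add: order_divides)
  ultimately have card_Y: "card {Y. peval fls_const F Y = fls_const c + fls_X} + 2 = d ^ n"
    using card_fls_zeros[of F w c] simple \<open>degree F > 0\<close> by simp
  interpret X_plus_c: transcendental_element fls_const "fls_const c + fls_X"
    by (rule transcendental_fls_X_plus_const)
  let ?\<psi> = "fract_eval fls_const (fls_const c + fls_X)"
  have "splits (map_poly \<phi> (gal_poly f n))"
    by (rule splits_separably_imp_splits[OF level_splits_separably[OF n(2)]])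
  then obtain E \<tau> where E: "subfield_hom E \<tau>" "range \<phi> \<subseteq> E"
    and im: "\<tau> ` (zeros (map_poly \<phi> (gal_poly f n)) \<inter> E) = zeros (map_poly ?\<psi> (gal_poly f n))"
    by (rule embedding_onto_zeros[OF X_plus_c.field_hom_fract_eval])
  interpret \<tau>: subfield_hom E \<tau> by (rule E(1))
  have "zeros (map_poly ?\<psi> (gal_poly f n)) = {Y. peval fls_const F Y = fls_const c + fls_X}"
    unfolding F_def X_plus_c.map_poly_fract_eval_gal_poly by auto
  then have "card (level n \<inter> E) = card {Y. peval fls_const F Y = fls_const c + fls_X}"
    using im card_image[OF \<tau>.inj_on_hom, of "level n \<inter> E"] by (simp add: zeros_gal_poly)
  then have "card (level n - E) = 2"
    using card_Y card_level[OF n(2)] finite_level[of n] by (simp add: card_Diff_subset_Int)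
  then show thesis using that E(2) \<tau>.subfield_axioms by blast
qed

lemma transposition_exists:
  assumes n: "1 \<le> n" "n \<le> N"
  obtains a b where "a \<in> level n" "b \<in> level n" "a \<noteq> b" "swaps n a b"
proof -
  obtain E where E: "subfield E" "range \<phi> \<subseteq> E" "card (level n - E) = 2"
    using subfield_omitting_two[OF n] .
  then obtain a b where ab: "level n - E = {a, b}" "a \<noteq> b" by (meson card_2_iff)
  then obtain \<sigma> where \<sigma>: "\<sigma> \<in> Gal" "\<And>y. y \<in> E \<Longrightarrow> \<sigma> y = y" "\<sigma> a = b" "\<sigma> b = a"
    using Gal_swaps_two_zeros[OF E(1,2), of "gal_poly f n" a b] by (auto simp: zeros_gal_poly)
  have "\<sigma> x = transpose a b x" if "x \<in> level n" for x
    using that ab(1) \<sigma>(2-4) by (cases "x \<in> {a, b}") (auto simp: transpose_def)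
  then have "swaps n a b" using \<sigma>(1) by (auto simp: swaps_def)
  then show thesis using that ab by blast
qed

lemma swaps_refl: "swaps n a a"
  unfolding swaps_def using Gal_id by (intro bexI[of _ id]) auto

lemma swaps_conj:
  assumes "swaps n a b" "\<rho> \<in> Gal"
  shows "swaps n (\<rho> a) (\<rho> b)"
proof -
  obtain \<sigma> where \<sigma>: "\<sigma> \<in> Gal" "\<And>x. x \<in> level n \<Longrightarrow> \<sigma> x = transpose a b x"
    using assms(1) unfolding swaps_def by blast
  note inv = Gal_inv[OF assms(2)] Gal_inv_apply[OF assms(2)]
  have "(\<rho> \<circ> \<sigma> \<circ> inv_into UNIV \<rho>) x = transpose (\<rho> a) (\<rho> b) x" if "x \<in> level n" for x
  proof -
    have "inv_into UNIV \<rho> x \<in> level n" using Gal_level[OF inv(1)] that .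
    then show ?thesis using \<sigma>(2) inv(2,3) by (auto simp: transpose_def)
  qed
  moreover have "\<rho> \<circ> \<sigma> \<circ> inv_into UNIV \<rho> \<in> Gal" by (intro Gal_comp \<sigma>(1) assms(2) inv(1))
  ultimately show ?thesis unfolding swaps_def by blast
qed

lemma swaps_trans:
  assumes "swaps n a b" "swaps n b c" "b \<in> level n" "c \<in> level n"
  shows "swaps n a c"
proof (cases "c = a \<or> c = b")
  case True
  then show ?thesis using assms swaps_refl by auto
next
  case False
  obtain \<sigma> where \<sigma>: "\<sigma> \<in> Gal" "\<And>x. x \<in> level n \<Longrightarrow> \<sigma> x = transpose a b x"
    using assms(1) unfolding swaps_def by blast
  have "swaps n (\<sigma> b) (\<sigma> c)" using swaps_conj[OF assms(2) \<sigma>(1)] .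
  then show ?thesis using \<sigma>(2) False assms(3,4) by simp
qed

lemma swaps_siblings:
  assumes "swaps n a b" "a \<in> level n" "1 \<le> n" "n \<le> N"
  shows "peval \<kappa> f a = peval \<kappa> f b"
proof (rule ccontr)
  assume neq: "peval \<kappa> f a \<noteq> peval \<kappa> f b"
  obtain \<sigma> where \<sigma>: "\<sigma> \<in> Gal" "\<And>x. x \<in> level n \<Longrightarrow> \<sigma> x = transpose a b x"
    using assms(1) unfolding swaps_def by blast
  obtain n' where n': "n = Suc n'" using assms(3) by (cases n) auto
  have parent: "peval \<kappa> f a \<in> level n'" using assms(2) unfolding n' level_Suc_iff .
  then have "card (fiber (peval \<kappa> f a)) = d" using card_fiber assms(4) n' by simp
  then have "\<not> fiber (peval \<kappa> f a) \<subseteq> {a}" using d_ge_2 card_mono[of "{a}" "fiber (peval \<kappa> f a)"]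
    by auto
  then obtain x where x: "x \<noteq> a" "peval \<kappa> f x = peval \<kappa> f a" unfolding fiber_def by blast
  then have "x \<in> level n" "x \<noteq> b" using parent neq by (auto simp: n' level_Suc_iff)
  then have "\<sigma> x = x" "\<sigma> a = b" using \<sigma>(2) assms(2) x(1) by simp_all
  then show False
    using Gal_peval[OF \<sigma>(1), of f x] Gal_peval[OF \<sigma>(1), of f a] x(2) neq by simp
qed

definition swap_class :: "nat \<Rightarrow> 'L \<Rightarrow> 'L set" where
  "swap_class n \<beta> = {b \<in> level n. swaps n \<beta> b}"

lemma finite_swap_class: "finite (swap_class n \<beta>)"
  by (simp add: swap_class_def finite_level)

lemma in_swap_class: "\<beta> \<in> level n \<Longrightarrow> \<beta> \<in> swap_class n \<beta>"
  by (simp add: swap_class_def swaps_refl)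

lemma swap_class_subset_fiber:
  assumes "1 \<le> n" "n \<le> N" "\<beta> \<in> level n"
  shows "swap_class n \<beta> \<subseteq> fiber (peval \<kappa> f \<beta>)"
  using swaps_siblings[OF _ assms(3,1,2)] by (auto simp: swap_class_def fiber_def)

lemma swap_class_invariant:
  assumes "\<sigma> \<in> Gal" "\<sigma> \<beta> \<in> swap_class n \<beta>"
  shows "\<sigma> ` swap_class n \<beta> = swap_class n \<beta>"
proof (rule card_subset_eq[OF finite_swap_class])
  show "\<sigma> ` swap_class n \<beta> \<subseteq> swap_class n \<beta>"
  proof
    fix x assume "x \<in> \<sigma> ` swap_class n \<beta>"
    then obtain b where b: "b \<in> level n" "swaps n \<beta> b" "x = \<sigma> b" by (auto simp: swap_class_def)
    then have "swaps n (\<sigma> \<beta>) x" "x \<in> level n" using swaps_conj Gal_level assms(1) by simp_all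
    then show "x \<in> swap_class n \<beta>"
      using assms(2) swaps_trans[of n \<beta> "\<sigma> \<beta>" x] by (simp add: swap_class_def)
  qed
  show "card (\<sigma> ` swap_class n \<beta>) = card (swap_class n \<beta>)"
    using Gal_eq_iff[OF assms(1)] by (intro card_image) (auto simp: inj_on_def)
qed

lemma swap_class_trivial_or_fiber:
  assumes n: "1 \<le> n" "n \<le> N" and \<beta>: "\<beta> \<in> level n"
  shows "swap_class n \<beta> = {\<beta>} \<or> swap_class n \<beta> = fiber (peval \<kappa> f \<beta>)"
proof -
  let ?B = "swap_class n \<beta>" and ?E = "range (fract_eval \<kappa> \<beta>)"
  interpret \<beta>: transcendental_element \<kappa> \<beta> by (rule level_transcendental[OF \<beta>])
  note \<beta>B = in_swap_class[OF \<beta>] and B_fiber = swap_class_subset_fiber[OF n \<beta>]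
  have C: "(\<Prod>b\<in>?B. [:- b, 1:]) \<in> polys_over ?E"
  proof (rule Gal_invariant_prod[OF \<beta>.subfield_simple_extension range_\<phi>_level[OF \<beta>]
        finite_swap_class])
    fix \<sigma> assume \<sigma>: "\<sigma> \<in> Gal" "\<And>y. y \<in> ?E \<Longrightarrow> \<sigma> y = y"
    have "\<sigma> \<beta> = \<beta>" using \<sigma>(2) \<beta>.fract_eval_X by (metis rangeI)
    then show "\<sigma> ` ?B \<subseteq> ?B" using swap_class_invariant[OF \<sigma>(1)] \<beta>B by simp
  qed
  have "\<exists>\<sigma>. field_hom \<sigma> \<and> (\<forall>a. \<sigma> (\<kappa> a) = \<kappa> a) \<and> \<sigma> \<beta> = b \<and> \<sigma> ` ?B = ?B" if b: "b \<in> ?B" for b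
  proof -
    obtain \<sigma> where \<sigma>: "\<sigma> \<in> Gal" "\<sigma> \<beta> = b" using b \<beta> by (auto simp: swap_class_def swaps_def)
    then show ?thesis
      using swap_class_invariant[OF \<sigma>(1)] b Gal_\<kappa>[OF \<sigma>(1)]
      by (intro exI[of _ \<sigma>]) (auto simp: Gal_iff)
  qed
  then have "card ?B = 1 \<or> card ?B = degree f"
    using indecomposable degree_f d_ge_2 B_fiber
    by (intro \<beta>.block_card_indecomposable[OF alg_closed _ _ finite_swap_class \<beta>B _ C])
      (auto simp: fiber_def)
  then show ?thesis
  proof
    assume "card ?B = 1"
    then show ?thesis using \<beta>B by (metis card_1_singletonE singletonD)
  next
    assume "card ?B = degree f"
    moreover obtain n' where n': "n = Suc n'" using n(1) by (cases n) auto
    then have "card (fiber (peval \<kappa> f \<beta>)) = d" using card_fiber \<beta> n(2) by (simp add: level_Suc_iff)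
    ultimately have "?B = fiber (peval \<kappa> f \<beta>)"
      using B_fiber finite_fiber degree_f by (intro card_subset_eq) simp_all
    then show ?thesis ..
  qed
qed

lemma all_siblings_swap:
  assumes n: "1 \<le> n" "n \<le> N" and \<beta>: "\<beta> \<in> level n" "peval \<kappa> f \<beta> = peval \<kappa> f \<beta>'"
  shows "swaps n \<beta> \<beta>'"
proof -
  obtain a b where ab: "a \<in> level n" "b \<in> level n" "a \<noteq> b" "swaps n a b"
    using transposition_exists[OF n] .
  obtain \<sigma> where \<sigma>: "\<sigma> \<in> Gal" "\<sigma> a = \<beta>" using Gal_transitive[OF ab(1) \<beta>(1)] .
  have "\<sigma> b \<in> swap_class n \<beta>"
    using swaps_conj[OF ab(4) \<sigma>(1)] \<sigma>(2) Gal_level[OF \<sigma>(1) ab(2)] by (simp add: swap_class_def)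
  moreover have "\<sigma> b \<noteq> \<beta>" using \<sigma> ab(3) Gal_eq_iff[OF \<sigma>(1), of b a] by auto
  ultimately have "swap_class n \<beta> = fiber (peval \<kappa> f \<beta>)"
    using swap_class_trivial_or_fiber[OF n \<beta>(1)] by blast
  moreover have "\<beta>' \<in> fiber (peval \<kappa> f \<beta>)" using \<beta>(2) by (simp add: fiber_def)
  ultimately show ?thesis by (auto simp: swap_class_def)
qed

lemma fiberwise_permutation_in_Gal:
  assumes n: "1 \<le> n" "n \<le> N" and "inj_on \<rho> (level n)"
    "\<And>x. x \<in> level n \<Longrightarrow> peval \<kappa> f (\<rho> x) = peval \<kappa> f x"
  shows "\<exists>\<sigma>\<in>Gal. \<forall>x\<in>level n. \<sigma> x = \<rho> x"
  using assms(3-)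
proof (induction "card {x\<in>level n. \<rho> x \<noteq> x}" arbitrary: \<rho> rule: less_induct)
  case less
  show ?case
  proof (cases "\<forall>x\<in>level n. \<rho> x = x")
    case True
    then show ?thesis using Gal_id by (intro bexI[of _ id]) auto
  next
    case False
    then obtain x where x: "x \<in> level n" "\<rho> x \<noteq> x" by blast
    have "swaps n x (\<rho> x)" using all_siblings_swap[OF n x(1)] less.prems(2)[OF x(1)] by simp
    then obtain \<sigma> where \<sigma>: "\<sigma> \<in> Gal" "\<And>z. z \<in> level n \<Longrightarrow> \<sigma> z = transpose x (\<rho> x) z"
      unfolding swaps_def by blast
    define \<rho>' where "\<rho>' = transpose x (\<rho> x) \<circ> \<rho>"
    have level: "\<rho> z \<in> level n" if "z \<in> level n" for z
      using that less.prems(2)[OF that] n(1) by (cases n) (simp_all add: level_Suc_iff)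
    have "\<rho>' z = z" if "z \<in> level n" "\<rho> z = z" for z
      using that x less.prems(1) by (auto simp: \<rho>'_def transpose_def dest: inj_onD)
    moreover have "\<rho>' x = x" by (simp add: \<rho>'_def)
    ultimately have "{z\<in>level n. \<rho>' z \<noteq> z} \<subset> {z\<in>level n. \<rho> z \<noteq> z}" using x by blast
    then have "card {z\<in>level n. \<rho>' z \<noteq> z} < card {z\<in>level n. \<rho> z \<noteq> z}"
      using finite_level by (intro psubset_card_mono) simp_all
    moreover have "inj_on \<rho>' (level n)"
      unfolding \<rho>'_def using less.prems(1) by (intro comp_inj_on) simp_all
    moreover have "peval \<kappa> f (\<rho>' z) = peval \<kappa> f z" if "z \<in> level n" for z
      using less.prems(2)[OF that] less.prems(2)[OF x(1)] by (auto simp: \<rho>'_def transpose_def)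
    ultimately obtain \<theta> where \<theta>: "\<theta> \<in> Gal" "\<forall>z\<in>level n. \<theta> z = \<rho>' z" using less.hyps by blast
    have "(\<sigma> \<circ> \<theta>) z = \<rho> z" if "z \<in> level n" for z
      using that \<theta>(2) Gal_level[OF \<theta>(1) that] \<sigma>(2) by (simp add: \<rho>'_def)
    then show ?thesis using Gal_comp[OF \<sigma>(1) \<theta>(1)] by blast
  qed
qed

end

section \<open>The action on the tree\<close>

definition words :: "nat \<Rightarrow> nat \<Rightarrow> nat list set" where
  "words d n = {v. length v = n \<and> set v \<subseteq> {0..<d}}"

lemma tree_verts_iff: "v \<in> tree_verts d N \<longleftrightarrow> length v \<le> N \<and> v \<in> words d (length v)"
  by (auto simp: tree_verts_def words_def)

lemma words_tree_verts: "v \<in> words d n \<Longrightarrow> n \<le> N \<Longrightarrow> v \<in> tree_verts d N"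
  by (auto simp: tree_verts_def words_def)

lemma words_length: "v \<in> words d n \<Longrightarrow> length v = n"
  by (simp add: words_def)

lemma words_0: "words d 0 = {[]}"
  by (auto simp: words_def)

lemma words_SucE:
  assumes "v \<in> words d (Suc n)"
  obtains u i where "v = u @ [i]" "u \<in> words d n" "i < d"
proof -
  have "v \<noteq> []" using assms by (auto simp: words_def)
  then have "v = butlast v @ [last v]" by simp
  moreover have "butlast v \<in> words d n" "last v < d"
    using assms last_in_set[OF \<open>v \<noteq> []\<close>] by (auto simp: words_def dest: in_set_butlastD)
  ultimately show thesis using that by blast
qed

lemma words_snoc: "u \<in> words d n \<Longrightarrow> i < d \<Longrightarrow> u @ [i] \<in> words d (Suc n)"
  by (auto simp: words_def)

lemma wreath_power_words:
  assumes "\<pi> \<in> carrier (wreath_power d N)" "v \<in> words d n" "n \<le> N"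
  shows "\<pi> v \<in> words d n"
proof -
  have v: "v \<in> tree_verts d N" using words_tree_verts assms(2,3) .
  then have "\<pi> v \<in> tree_verts d N" "length (\<pi> v) = n"
    using assms(1) words_length[OF assms(2)] by (auto simp: wreath_power_def dest: bij_betwE)
  then show ?thesis by (auto simp: tree_verts_iff)
qed

lemma wreath_power_inj_on_words:
  assumes "\<pi> \<in> carrier (wreath_power d N)" "n \<le> N"
  shows "inj_on \<pi> (words d n)"
proof (rule inj_on_subset)
  show "inj_on \<pi> (tree_verts d N)" using assms(1) by (simp add: wreath_power_def bij_betw_def)
  show "words d n \<subseteq> tree_verts d N" using words_tree_verts assms(2) by blast
qed

lemma wreath_power_butlast:
  assumes "\<pi> \<in> carrier (wreath_power d N)" "v \<in> words d n" "n \<le> N"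
  shows "\<pi> (butlast v) = butlast (\<pi> v)"
  using assms words_tree_verts[OF assms(2,3)] by (simp add: wreath_power_def)

context iterated_splitting_field
begin

definition child :: "'L \<Rightarrow> nat \<Rightarrow> 'L" where
  "child \<alpha> = (SOME h. bij_betw h {0..<d} (fiber \<alpha>))"

definition label :: "nat list \<Rightarrow> 'L" where
  "label v = foldl child T v"

definition vertex :: "nat \<Rightarrow> 'L \<Rightarrow> nat list" where
  "vertex n = the_inv_into (words d n) label"

definition tree_act :: "('L \<Rightarrow> 'L) \<Rightarrow> nat list \<Rightarrow> nat list" where
  "tree_act \<sigma> v = (if v \<in> tree_verts d N then vertex (length v) (\<sigma> (label v)) else v)"

lemma child_bij:
  assumes "\<alpha> \<in> level n" "n < N"
  shows "bij_betw (child \<alpha>) {0..<d} (fiber \<alpha>)"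
proof -
  have "\<exists>h. bij_betw h {0..<d} (fiber \<alpha>)"
    using ex_bij_betw_nat_finite[OF finite_fiber[of \<alpha>]] card_fiber[OF assms] by simp
  then show ?thesis unfolding child_def by (rule someI_ex)
qed

lemma label_Nil: "label [] = T" and label_snoc: "label (v @ [i]) = child (label v) i"
  by (simp_all add: label_def)

lemma child_parent:
  assumes "\<alpha> \<in> level n" "n < N" "i < d"
  shows "peval \<kappa> f (child \<alpha> i) = \<alpha>"
  using bij_betwE[OF child_bij[OF assms(1,2)]] assms(3) by (simp add: fiber_def)

lemma label_bij: "n \<le> N \<Longrightarrow> bij_betw label (words d n) (level n)"
proof (induction n)
  case 0
  then show ?case by (simp add: words_0 level_0 label_Nil bij_betw_def)
next
  case (Suc n)
  then have IH: "bij_betw label (words d n) (level n)" and n: "n < N" by auto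
  have level: "label u \<in> level n" if "u \<in> words d n" for u using bij_betwE[OF IH] that by blast
  note child = child_bij[OF level n] and parent = child_parent[OF level n, folded label_snoc]
  show ?case
  proof (rule bij_betwI')
    fix v v' assume "v \<in> words d (Suc n)" "v' \<in> words d (Suc n)"
    then obtain u i u' i' where v: "v = u @ [i]" "u \<in> words d n" "i < d"
      and v': "v' = u' @ [i']" "u' \<in> words d n" "i' < d"
      by (metis words_SucE)
    show "(label v = label v') = (v = v')"
    proof
      assume eq: "label v = label v'"
      then have "label u = label u'" using parent v v' by metis
      then have u: "u = u'" using bij_betw_imp_inj_on[OF IH] v(2) v'(2) by (auto dest: inj_onD)
      then have "i = i'"
        using eq v v' bij_betw_imp_inj_on[OF child[OF v(2)]]
        by (auto simp: label_snoc dest: inj_onD)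
      then show "v = v'" using u v(1) v'(1) by simp
    qed simp
  next
    fix v assume "v \<in> words d (Suc n)"
    then obtain u i where "v = u @ [i]" "u \<in> words d n" "i < d" by (rule words_SucE)
    then show "label v \<in> level (Suc n)" using parent bij_betwE[OF IH] by (simp add: level_Suc_iff)
  next
    fix x assume "x \<in> level (Suc n)"
    then have "peval \<kappa> f x \<in> label ` words d n"
      by (simp add: level_Suc_iff bij_betw_imp_surj_on[OF IH])
    then obtain u where u: "u \<in> words d n" "x \<in> fiber (label u)" by (auto simp: fiber_def)
    then have "x \<in> child (label u) ` {0..<d}" by (simp add: bij_betw_imp_surj_on[OF child])
    then show "\<exists>v\<in>words d (Suc n). x = label v"
      using words_snoc[OF u(1)] by (auto simp flip: label_snoc)
  qed
qed

lemma label_level: "v \<in> words d n \<Longrightarrow> n \<le> N \<Longrightarrow> label v \<in> level n"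
  using bij_betwE[OF label_bij] by blast

lemma label_inj_on: "n \<le> N \<Longrightarrow> inj_on label (words d n)"
  by (rule bij_betw_imp_inj_on[OF label_bij])

lemma vertex_label: "v \<in> words d n \<Longrightarrow> n \<le> N \<Longrightarrow> vertex n (label v) = v"
  unfolding vertex_def by (rule the_inv_into_f_f[OF label_inj_on])

lemma vertex_bij: "n \<le> N \<Longrightarrow> bij_betw (vertex n) (level n) (words d n)"
  unfolding vertex_def by (rule bij_betw_the_inv_into[OF label_bij])

lemma label_vertex: "x \<in> level n \<Longrightarrow> n \<le> N \<Longrightarrow> label (vertex n x) = x"
  unfolding vertex_def by (rule f_the_inv_into_f_bij_betw[OF label_bij])

lemma butlast_words: "v \<in> words d (Suc n) \<Longrightarrow> butlast v \<in> words d n"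
  by (auto elim: words_SucE)

lemma label_butlast:
  assumes "v \<in> words d (Suc n)" "Suc n \<le> N"
  shows "peval \<kappa> f (label v) = label (butlast v)"
proof -
  obtain u i where u: "v = u @ [i]" "u \<in> words d n" "i < d" using words_SucE[OF assms(1)] .
  then show ?thesis using child_parent[OF label_level[OF u(2)] _ u(3)] assms(2)
    by (simp add: label_snoc)
qed

lemma tree_act_words:
  assumes "\<sigma> \<in> Gal" "v \<in> words d n" "n \<le> N"
  shows "tree_act \<sigma> v \<in> words d n" "label (tree_act \<sigma> v) = \<sigma> (label v)"
proof -
  have "tree_act \<sigma> v = vertex n (\<sigma> (label v))"
    using assms words_tree_verts words_length by (simp add: tree_act_def)
  moreover have "\<sigma> (label v) \<in> level n" using Gal_level[OF assms(1) label_level[OF assms(2,3)]] .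
  ultimately show "tree_act \<sigma> v \<in> words d n" "label (tree_act \<sigma> v) = \<sigma> (label v)"
    using bij_betwE[OF vertex_bij] label_vertex assms(3) by simp_all
qed

lemma tree_act_eqI:
  assumes "u \<in> words d n" "label u = \<sigma> (label v)" "v \<in> words d n" "n \<le> N"
  shows "tree_act \<sigma> v = u"
  using vertex_label[OF assms(1,4)] assms words_tree_verts words_length by (simp add: tree_act_def)

lemma tree_act_tree_verts:
  "\<sigma> \<in> Gal \<Longrightarrow> v \<in> tree_verts d N \<Longrightarrow> tree_act \<sigma> v \<in> tree_verts d N"
  using tree_act_words(1) words_tree_verts tree_verts_iff by blast

lemma tree_act_comp:
  assumes "\<sigma> \<in> Gal" "\<tau> \<in> Gal"
  shows "tree_act (\<sigma> \<circ> \<tau>) = tree_act \<sigma> \<circ> tree_act \<tau>"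
proof
  fix v
  show "tree_act (\<sigma> \<circ> \<tau>) v = (tree_act \<sigma> \<circ> tree_act \<tau>) v"
  proof (cases "v \<in> tree_verts d N")
    case True
    then have v: "v \<in> words d (length v)" "length v \<le> N" by (auto simp: tree_verts_iff)
    note \<tau>v = tree_act_words[OF assms(2) v]
    note \<sigma>\<tau>v = tree_act_words[OF assms(1) \<tau>v(1) v(2)]
    show ?thesis using \<sigma>\<tau>v \<tau>v(2) v by (intro tree_act_eqI) simp_all
  qed (simp add: tree_act_def)
qed

lemma tree_act_id: "tree_act id = id"
proof
  fix v
  show "tree_act id v = id v"
    by (cases "v \<in> tree_verts d N") (auto simp: tree_verts_iff tree_act_def vertex_label)
qed

lemma tree_act_bij:
  assumes "\<sigma> \<in> Gal"
  shows "bij_betw (tree_act \<sigma>) (tree_verts d N) (tree_verts d N)"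
proof -
  let ?\<tau> = "inv_into UNIV \<sigma>"
  have "\<sigma> \<circ> ?\<tau> = id" "?\<tau> \<circ> \<sigma> = id" using Gal_inv_apply[OF assms] by auto
  then have "tree_act \<sigma> (tree_act ?\<tau> v) = v" "tree_act ?\<tau> (tree_act \<sigma> v) = v" for v
    using tree_act_comp[OF assms Gal_inv[OF assms]]
      tree_act_comp[OF Gal_inv[OF assms] assms] tree_act_id
    by (metis comp_apply id_apply)+
  then show ?thesis
    using tree_act_tree_verts assms Gal_inv by (intro bij_betw_byWitness[of _ "tree_act ?\<tau>"]) auto
qed

lemma tree_act_butlast:
  assumes \<sigma>: "\<sigma> \<in> Gal" and v: "v \<in> words d n" "n \<le> N"
  shows "tree_act \<sigma> (butlast v) = butlast (tree_act \<sigma> v)"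
proof (cases n)
  case 0
  then show ?thesis using tree_act_words(1)[OF \<sigma> v] v by (simp add: words_0)
next
  case (Suc m)
  note \<sigma>v = tree_act_words[OF \<sigma> v, unfolded Suc] and v = v[unfolded Suc]
  show ?thesis
  proof (rule tree_act_eqI[OF butlast_words[OF \<sigma>v(1)] _ butlast_words[OF v(1)]])
    show "label (butlast (tree_act \<sigma> v)) = \<sigma> (label (butlast v))"
      using Gal_peval[OF \<sigma>, of f "label v"] \<sigma>v(2) label_butlast[OF \<sigma>v(1) v(2)] label_butlast[OF v]
      by simp
  qed (use v(2) in simp)
qed

lemma tree_act_in_wreath_power:
  assumes "\<sigma> \<in> Gal"
  shows "tree_act \<sigma> \<in> carrier (wreath_power d N)"
proof -
  have "length (tree_act \<sigma> v) = length v \<and> tree_act \<sigma> (butlast v) = butlast (tree_act \<sigma> v)"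
    if "v \<in> tree_verts d N" for v
    using that tree_act_butlast[OF assms, of v "length v"]
      words_length[OF tree_act_words(1)[OF assms, of v "length v"]]
    by (simp add: tree_verts_iff)
  then show ?thesis using tree_act_bij[OF assms] by (simp add: wreath_power_def tree_act_def)
qed

lemma tree_act_inj: "inj_on tree_act Gal"
proof (rule inj_onI)
  fix \<sigma> \<tau> assume \<sigma>: "\<sigma> \<in> Gal" and \<tau>: "\<tau> \<in> Gal" and eq: "tree_act \<sigma> = tree_act \<tau>"
  interpret \<sigma>: field_hom \<sigma> using \<sigma> by (simp add: Gal_iff)
  interpret \<tau>: field_hom \<tau> using \<tau> by (simp add: Gal_iff)
  define S where "S = {x. \<sigma> x = \<tau> x}"
  have "subfield S"
    by unfold_locales (auto simp: S_def \<sigma>.hom_add \<tau>.hom_add \<sigma>.hom_mult \<tau>.hom_mult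
        \<sigma>.hom_uminus \<tau>.hom_uminus \<sigma>.hom_inverse \<tau>.hom_inverse)
  moreover have "range \<phi> \<subseteq> S" using \<sigma> \<tau> by (auto simp: S_def Gal_iff)
  moreover have "level N \<subseteq> S"
  proof
    fix x assume "x \<in> level N"
    then obtain v where v: "v \<in> words d N" "x = label v"
      using bij_betw_imp_surj_on[OF label_bij[OF order_refl]] by blast
    then show "x \<in> S"
      using tree_act_words(2)[OF \<sigma> v(1)] tree_act_words(2)[OF \<tau> v(1)] eq by (simp add: S_def)
  qed
  ultimately have "S = UNIV" by (intro zeros_generate) (simp_all add: zeros_gal_poly)
  then show "\<sigma> = \<tau>" by (auto simp: S_def)
qed

lemma label_parent_wreath_power:
  assumes "\<pi> \<in> carrier (wreath_power d N)" "v \<in> words d (Suc n)" "Suc n \<le> N"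
  shows "peval \<kappa> f (label (\<pi> v)) = label (\<pi> (butlast v))"
  using label_butlast[OF wreath_power_words[OF assms] assms(3)] wreath_power_butlast[OF assms]
  by simp

lemma lift_to_next_level:
  assumes \<pi>: "\<pi> \<in> carrier (wreath_power d N)" and n: "Suc n \<le> N"
    and \<sigma>: "\<sigma> \<in> Gal" "\<And>v. v \<in> words d n \<Longrightarrow> \<sigma> (label v) = label (\<pi> v)"
  obtains \<sigma>' where "\<sigma>' \<in> Gal" "\<And>v. v \<in> words d (Suc n) \<Longrightarrow> \<sigma>' (label v) = label (\<pi> v)"
proof -
  let ?\<tau> = "inv_into UNIV \<sigma>" and ?W = "words d (Suc n)" and ?L = "level (Suc n)"
  note inv = Gal_inv[OF \<sigma>(1)] Gal_inv_apply[OF \<sigma>(1)]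
  define \<rho> where "\<rho> = ?\<tau> \<circ> label \<circ> \<pi> \<circ> vertex (Suc n)"
  have "\<exists>\<theta>\<in>Gal. \<forall>x\<in>?L. \<theta> x = \<rho> x"
  proof (rule fiberwise_permutation_in_Gal)
    have "vertex (Suc n) ` ?L = ?W" "\<pi> ` ?W \<subseteq> ?W"
      using bij_betw_imp_surj_on[OF vertex_bij[OF n]] wreath_power_words[OF \<pi> _ n] by auto
    moreover have "inj ?\<tau>" using Gal_eq_iff[OF inv(1)] by (auto simp: inj_on_def)
    ultimately show "inj_on \<rho> ?L"
      unfolding \<rho>_def
      using bij_betw_imp_inj_on[OF vertex_bij[OF n]] wreath_power_inj_on_words[OF \<pi> n]
        label_inj_on[OF n]
      by (intro comp_inj_on) (auto intro: inj_on_subset)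
    fix x assume "x \<in> ?L"
    then have v: "vertex (Suc n) x \<in> ?W" "label (vertex (Suc n) x) = x"
      using bij_betwE[OF vertex_bij[OF n]] label_vertex n by auto
    have "peval \<kappa> f (\<rho> x) = ?\<tau> (label (\<pi> (butlast (vertex (Suc n) x))))"
      by (simp add: \<rho>_def label_parent_wreath_power[OF \<pi> v(1) n] flip: Gal_peval[OF inv(1)])
    also have "\<dots> = label (butlast (vertex (Suc n) x))"
      by (simp add: inv(3) flip: \<sigma>(2)[OF butlast_words[OF v(1)]])
    also have "\<dots> = peval \<kappa> f x" using label_butlast[OF v(1) n] v(2) by simp
    finally show "peval \<kappa> f (\<rho> x) = peval \<kappa> f x" .
  qed (use n in auto)
  then obtain \<theta> where \<theta>: "\<theta> \<in> Gal" "\<forall>x\<in>?L. \<theta> x = \<rho> x" by blast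
  have "(\<sigma> \<circ> \<theta>) (label v) = label (\<pi> v)" if "v \<in> ?W" for v
    using \<theta>(2) label_level[OF that n] vertex_label[OF that n] inv(2) by (simp add: \<rho>_def)
  then show thesis using that Gal_comp[OF \<sigma>(1) \<theta>(1)] by blast
qed

lemma wreath_power_realized_on_level:
  assumes \<pi>: "\<pi> \<in> carrier (wreath_power d N)"
  shows "n \<le> N \<Longrightarrow> \<exists>\<sigma>\<in>Gal. \<forall>v\<in>words d n. \<sigma> (label v) = label (\<pi> v)"
proof (induction n)
  case 0
  have "\<pi> [] = []" using wreath_power_words[OF \<pi>, of "[]" 0] by (simp add: words_0)
  then show ?case using Gal_id by (intro bexI[of _ id]) (auto simp: words_0)
next
  case (Suc n)
  then obtain \<sigma> where "\<sigma> \<in> Gal" "\<And>v. v \<in> words d n \<Longrightarrow> \<sigma> (label v) = label (\<pi> v)" by auto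
  then show ?case using lift_to_next_level[OF \<pi> Suc.prems] by metis
qed

lemma realized_on_lower_levels:
  assumes \<pi>: "\<pi> \<in> carrier (wreath_power d N)" and \<sigma>: "\<sigma> \<in> Gal"
    and top: "\<forall>v\<in>words d N. \<sigma> (label v) = label (\<pi> v)"
  shows "n \<le> N \<Longrightarrow> \<forall>v\<in>words d n. \<sigma> (label v) = label (\<pi> v)"
proof (induction rule: inc_induct)
  case (step n)
  show ?case
  proof
    fix v assume "v \<in> words d n"
    then have v: "v @ [0] \<in> words d (Suc n)" using words_snoc d_ge_2 by simp
    have n: "Suc n \<le> N" using step by simp
    have "\<sigma> (label v) = \<sigma> (peval \<kappa> f (label (v @ [0])))" using label_butlast[OF v n] by simp
    also have "\<dots> = peval \<kappa> f (label (\<pi> (v @ [0])))" using Gal_peval[OF \<sigma>] step.IH v by simp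
    also have "\<dots> = label (\<pi> v)" using label_parent_wreath_power[OF \<pi> v n] by simp
    finally show "\<sigma> (label v) = label (\<pi> v)" .
  qed
qed (rule top)

lemma tree_act_surj:
  assumes \<pi>: "\<pi> \<in> carrier (wreath_power d N)"
  obtains \<sigma> where "\<sigma> \<in> Gal" "tree_act \<sigma> = \<pi>"
proof -
  obtain \<sigma> where \<sigma>: "\<sigma> \<in> Gal" "\<forall>v\<in>words d N. \<sigma> (label v) = label (\<pi> v)"
    using wreath_power_realized_on_level[OF \<pi> order_refl] by blast
  have "tree_act \<sigma> v = \<pi> v" for v
  proof (cases "v \<in> tree_verts d N")
    case True
    then have v: "v \<in> words d (length v)" "length v \<le> N" by (auto simp: tree_verts_iff)
    show ?thesis
      using realized_on_lower_levels[OF \<pi> \<sigma> v(2)] v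
      by (intro tree_act_eqI wreath_power_words[OF \<pi>]) simp_all
  next
    case False
    then show ?thesis using \<pi> by (simp add: tree_act_def wreath_power_def)
  qed
  then show thesis using that \<sigma>(1) by blast
qed

theorem gal_group_iso_wreath_power: "gal_group \<phi> \<cong> wreath_power d N"
proof -
  have "tree_act \<in> hom (gal_group \<phi>) (wreath_power d N)"
    using tree_act_in_wreath_power tree_act_comp
    by (intro homI) (auto simp: gal_group_def wreath_power_def)
  moreover have "tree_act ` Gal = carrier (wreath_power d N)"
    using tree_act_in_wreath_power by (auto elim: tree_act_surj)
  ultimately show ?thesis
    using tree_act_inj unfolding is_iso_def iso_def bij_betw_def by blast
qed

end

theorem theorem3p7:
  fixes f :: "'k::field poly" and d N :: nat
    and \<phi> :: "'k poly fract \<Rightarrow> 'L::field"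
  assumes "alg_closed_field TYPE('k)"
    and "d \<ge> 2" and "N \<ge> 1"
    and "\<not> (d = 2 \<and> CHAR('k) = 2)"
    and "f \<in> H_set d N TYPE('k)"
    and "is_splitting_field \<phi> (gal_poly f N)"
  shows "gal_group \<phi> \<cong> wreath_power d N"
proof -
  interpret iterated_splitting_field f d N \<phi>
    using assms by unfold_locales
  show ?thesis by (rule gal_group_iso_wreath_power)
qed

end
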